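(* Let $(X,d,\alpha)$ be a computable metric space and let $S$ and $T$ be semi-computable compact sets in this space such that $T\subseteq S$. Suppose $x\in S$ is a point which has a neighborhood $U$ (in $S$) with the following property: for some $n\ge1$ there exists a homeomorphism $f:\mathbb H^n\to U$ such that $f(\mathrm{Bd}\,\mathbb H^n)=U\cap T$. Then there exists a neighborhood of $x$ in $S$ which is computable up to $S$.
   Context: $\mathbb H^n=\{(x_1,\dots,x_n)\in\mathbb R^n:x_n\ge0\}$ and $\mathrm{Bd}\,\mathbb H^n=\{(x_1,\dots,x_n)\in\mathbb H^n: x_n=0\}$. A computable metric space is a triple $(X,d,\alpha)$ where $(X,d)$ is a metric space and $\alpha=(\alpha_i)_{i\in\mathbb N}$ is a sequence with dense range in $(X,d)$ such that $(i,j)\mapsto d(\alpha_i,\alpha_j)$ is a computable function $\mathbb N^2\to\mathbb R$ (a function $g:\mathbb N^k\to\mathbb R$ is computable if there is a computable $G:\mathbb N^{k+1}\to\mathbb Q$ with $|g(x)-G(x,i)|<2^{-i}$ for all $x,i$). Fix a computable $q:\mathbb N\to\mathbb Q$ whose image is the set of positive rationals and computable $\tau_1,\tau_2:\mathbb N\to\mathbb N$ with $\{(\tau_1(i),\tau_2(i)):i\in\mathbb N\}=\mathbb N^2$; let $\lambda_i=\alpha_{\tau_1(i)}$, $\rho_i=q_{\tau_2(i)}$, $I_i=B(\lambda_i,\rho_i)$ (open ball). Fix computable $\sigma:\mathbb N^2\to\mathbb N$, $\eta:\mathbb N\to\mathbb N$ such that $\{(\sigma(j,0),\dots,\sigma(j,\eta(j))):j\in\mathbb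 N\}$ is the set of all nonempty finite sequences in $\mathbb N$; let $[j]=\{\sigma(j,i):0\le i\le\eta(j)\}$, $J_j=\bigcup_{i\in[j]}I_i$ and $\Lambda_j=\{\alpha_i:i\in[j]\}$. A set $K\subseteq X$ is a semi-computable compact set if $K$ is compact in $(X,d)$ and $\{j\in\mathbb N: K\subseteq J_j\}$ is computably enumerable. For $A,B\subseteq X$ and $\varepsilon>0$ write $A\prec_\varepsilon B$ if for each $a\in A$ there is $b\in B$ with $d(a,b)<\varepsilon$. For $A\subseteq B\subseteq X$, $A$ is computable up to $B$ if there is a computable $f:\mathbb N\to\mathbb N$ with $A\prec_{2^{-k}}\Lambda_{f(k)}$ and $\Lambda_{f(k)}\prec_{2^{-k}}B$ for all $k$. A neighborhood of $x$ in $S$ is a subset of $S$ containing $x$ in its interior relative to $S$. *)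

theory Defs
  imports "HOL-Analysis.Analysis"
begin

datatype recf = Zero | Succ | Proj nat | Comp recf "recf list" | Prim recf recf | Mn recf

inductive eval :: "recf \<Rightarrow> nat list \<Rightarrow> nat \<Rightarrow> bool" where
  eval_zero: "eval Zero xs 0"
| eval_succ: "eval Succ (x # xs) (Suc x)"
| eval_proj: "i < length xs \<Longrightarrow> eval (Proj i) xs (xs ! i)"
| eval_comp: "length ys = length gs \<Longrightarrow> (\<forall>i<length gs. eval (gs ! i) xs (ys ! i))
      \<Longrightarrow> eval f ys y \<Longrightarrow> eval (Comp f gs) xs y"
| eval_prim0: "eval f xs y \<Longrightarrow> eval (Prim f g) (0 # xs) y"
| eval_primS: "eval (Prim f g) (n # xs) z \<Longrightarrow> eval g (z # n # xs) y
      \<Longrightarrow> eval (Prim f g) (Suc n # xs) y"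
| eval_mn: "eval f (n # xs) 0 \<Longrightarrow> (\<forall>m<n. \<exists>k. eval f (m # xs) (Suc k))
      \<Longrightarrow> eval (Mn f) xs n"

definition computable1 :: "(nat \<Rightarrow> nat) \<Rightarrow> bool" where
  "computable1 f \<longleftrightarrow> (\<exists>p. \<forall>a. eval p [a] (f a))"

definition computable2 :: "(nat \<Rightarrow> nat \<Rightarrow> nat) \<Rightarrow> bool" where
  "computable2 f \<longleftrightarrow> (\<exists>p. \<forall>a b. eval p [a, b] (f a b))"

definition computable3 :: "(nat \<Rightarrow> nat \<Rightarrow> nat \<Rightarrow> nat) \<Rightarrow> bool" where
  "computable3 f \<longleftrightarrow> (\<exists>p. \<forall>a b c. eval p [a, b, c] (f a b c))"

definition c_e :: "nat set \<Rightarrow> bool" where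
  "c_e A \<longleftrightarrow> (\<exists>p. \<forall>a. a \<in> A \<longleftrightarrow> (\<exists>y. eval p [a] y))"

definition rat_code :: "nat \<Rightarrow> real" where
  "rat_code n = (case prod_decode n of (a, r) \<Rightarrow>
      (case prod_decode r of (b, c) \<Rightarrow> (real a - real b) / (real c + 1)))"

definition computable_rat1 :: "(nat \<Rightarrow> real) \<Rightarrow> bool" where
  "computable_rat1 q \<longleftrightarrow> (\<exists>c. computable1 c \<and> (\<forall>i. q i = rat_code (c i)))"

definition computable_real2 :: "(nat \<Rightarrow> nat \<Rightarrow> real) \<Rightarrow> bool" where
  "computable_real2 g \<longleftrightarrow> (\<exists>G. computable3 G \<and>
     (\<forall>a b i. \<bar>g a b - rat_code (G a b i)\<bar> < (1/2) ^ i))"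

definition computable_metric_space :: "(nat \<Rightarrow> 'a::metric_space) \<Rightarrow> bool" where
  "computable_metric_space \<alpha> \<longleftrightarrow> closure (range \<alpha>) = UNIV \<and>
     computable_real2 (\<lambda>i j. dist (\<alpha> i) (\<alpha> j))"

definition good_enum :: "(nat \<Rightarrow> real) \<Rightarrow> (nat \<Rightarrow> nat) \<Rightarrow> (nat \<Rightarrow> nat)
     \<Rightarrow> (nat \<Rightarrow> nat \<Rightarrow> nat) \<Rightarrow> (nat \<Rightarrow> nat) \<Rightarrow> bool" where
  "good_enum q \<tau>1 \<tau>2 \<sigma> \<eta> \<longleftrightarrow>
     computable_rat1 q \<and> range q = {r \<in> \<rat>. 0 < r} \<and>
     computable1 \<tau>1 \<and> computable1 \<tau>2 \<and> range (\<lambda>i. (\<tau>1 i, \<tau>2 i)) = UNIV \<and>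
     computable2 \<sigma> \<and> computable1 \<eta> \<and>
     range (\<lambda>j. map (\<sigma> j) [0..<Suc (\<eta> j)]) = {l. l \<noteq> []}"

definition ball_I :: "(nat \<Rightarrow> 'a::metric_space) \<Rightarrow> (nat \<Rightarrow> real) \<Rightarrow> (nat \<Rightarrow> nat) \<Rightarrow> (nat \<Rightarrow> nat)
     \<Rightarrow> nat \<Rightarrow> 'a set" where
  "ball_I \<alpha> q \<tau>1 \<tau>2 i = ball (\<alpha> (\<tau>1 i)) (q (\<tau>2 i))"

definition idx :: "(nat \<Rightarrow> nat \<Rightarrow> nat) \<Rightarrow> (nat \<Rightarrow> nat) \<Rightarrow> nat \<Rightarrow> nat set" where
  "idx \<sigma> \<eta> j = (\<lambda>i. \<sigma> j i) ` {0..\<eta> j}"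

definition union_J :: "(nat \<Rightarrow> 'a::metric_space) \<Rightarrow> (nat \<Rightarrow> real) \<Rightarrow> (nat \<Rightarrow> nat) \<Rightarrow> (nat \<Rightarrow> nat)
     \<Rightarrow> (nat \<Rightarrow> nat \<Rightarrow> nat) \<Rightarrow> (nat \<Rightarrow> nat) \<Rightarrow> nat \<Rightarrow> 'a set" where
  "union_J \<alpha> q \<tau>1 \<tau>2 \<sigma> \<eta> j = (\<Union>i\<in>idx \<sigma> \<eta> j. ball_I \<alpha> q \<tau>1 \<tau>2 i)"

definition Lam :: "(nat \<Rightarrow> 'a) \<Rightarrow> (nat \<Rightarrow> nat \<Rightarrow> nat) \<Rightarrow> (nat \<Rightarrow> nat) \<Rightarrow> nat \<Rightarrow> 'a set" where
  "Lam \<alpha> \<sigma> \<eta> j = \<alpha> ` idx \<sigma> \<eta> j"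

definition semi_computable_compact :: "(nat \<Rightarrow> 'a::metric_space) \<Rightarrow> (nat \<Rightarrow> real) \<Rightarrow> (nat \<Rightarrow> nat)
     \<Rightarrow> (nat \<Rightarrow> nat) \<Rightarrow> (nat \<Rightarrow> nat \<Rightarrow> nat) \<Rightarrow> (nat \<Rightarrow> nat) \<Rightarrow> 'a set \<Rightarrow> bool" where
  "semi_computable_compact \<alpha> q \<tau>1 \<tau>2 \<sigma> \<eta> K \<longleftrightarrow>
     compact K \<and> c_e {j. K \<subseteq> union_J \<alpha> q \<tau>1 \<tau>2 \<sigma> \<eta> j}"

definition prec :: "'a::metric_space set \<Rightarrow> real \<Rightarrow> 'a set \<Rightarrow> bool" where
  "prec A e B \<longleftrightarrow> (\<forall>a\<in>A. \<exists>b\<in>B. dist a b < e)"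

definition computable_upto :: "(nat \<Rightarrow> 'a::metric_space) \<Rightarrow> (nat \<Rightarrow> nat \<Rightarrow> nat) \<Rightarrow> (nat \<Rightarrow> nat)
     \<Rightarrow> 'a set \<Rightarrow> 'a set \<Rightarrow> bool" where
  "computable_upto \<alpha> \<sigma> \<eta> A B \<longleftrightarrow> (\<exists>f. computable1 f \<and>
     (\<forall>k. prec A ((1/2) ^ k) (Lam \<alpha> \<sigma> \<eta> (f k)) \<and> prec (Lam \<alpha> \<sigma> \<eta> (f k)) ((1/2) ^ k) B))"

definition neighborhood_in :: "'a::topological_space set \<Rightarrow> 'a \<Rightarrow> 'a set \<Rightarrow> bool" where
  "neighborhood_in S x N \<longleftrightarrow> N \<subseteq> S \<and> (\<exists>V. openin (top_of_set S) V \<and> x \<in> V \<and> V \<subseteq> N)"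

section \<open>Half-space H^n inside R^N (vectors x : nat => real, coordinates 1..n, rest 0)\<close>

definition Rn :: "nat \<Rightarrow> (nat \<Rightarrow> real) set" where
  "Rn n = {x. \<forall>i. (i = 0 \<or> n < i) \<longrightarrow> x i = 0}"

definition halfspace :: "nat \<Rightarrow> (nat \<Rightarrow> real) set" where
  "halfspace n = {x \<in> Rn n. 0 \<le> x n}"

definition halfspace_bd :: "nat \<Rightarrow> (nat \<Rightarrow> real) set" where
  "halfspace_bd n = {x \<in> halfspace n. x n = 0}"

end

(*
Near x the set S is parametrized by cubes of the half-space. Inside a cube around the parameter of x
one can semidecide, from a cover of S alone, that a rational ball meets S: the certificate is a finite
cover of S by that ball, by balls far from the cube, and by n pairs of disjoint families, where the
k-th pair avoids the two faces orthogonal to the k-th direction. By the combinatorial lemma behind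
Brouwer's fixed point theorem the n pairs cannot cover the cube, so the ball must meet it. The faces
can be kept away from by finitely many fixed rational balls, except the face inside the boundary
hyperplane, which lies in T and is avoided through the semicomputability of T. Enumerating covers of
S that consist, near x, of small balls certified in this way yields the computable approximations.
*)
theory Submission
  imports Defs
begin

section \<open>Computable functions of one argument\<close>

text \<open>Semicomputability gives covers, and covers give only outer information: they can show
  that a ball misses \<open>S\<close>, never that it meets \<open>S\<close>. The missing inner
  information comes from dimension, because the failure to cover a cell by separated pairs can be
  exploited through finite certificates. The map \<open>f\<close> carries no effectivity. It is used
  only to select finitely many rational balls and to prove that the resulting searches are correct;
  these balls are fixed without computing them, since only the existence of a program is claimed.
  Four concentric cubes about the parameter of \<open>x\<close> leave room between the stages.
  Radius \<open>s\<close> gives the neighborhood, every small ball around a point of radius below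
  \<open>2 * s\<close> is eventually certified, a certificate proves an intersection with the cell
  of radius \<open>3 * s\<close>, and radius \<open>4 * s\<close> is where the parametrization of
  \<open>S\<close> is used. The gaps let finitely many balls do the separating. At the boundary
  hyperplane there is no gap: points with positive last coordinate are separated from
  \<open>T\<close> by searching, and points on the hyperplane are approximated by such points inside
  the same open ball.\<close>

abbreviation pr :: "nat \<Rightarrow> nat \<Rightarrow> nat" where
  "pr a b \<equiv> prod_encode (a, b)"

abbreviation pfst :: "nat \<Rightarrow> nat" where
  "pfst a \<equiv> fst (prod_decode a)"

abbreviation psnd :: "nat \<Rightarrow> nat" where
  "psnd a \<equiv> snd (prod_decode a)"

lemma eval_comp1: "eval g xs u \<Longrightarrow> eval f [u] y \<Longrightarrow> eval (Comp f [g]) xs y"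
  by (rule eval_comp[where ys = "[u]"]) auto

lemma eval_comp2:
  "eval g xs u \<Longrightarrow> eval h xs v \<Longrightarrow> eval f [u, v] y \<Longrightarrow> eval (Comp f [g, h]) xs y"
  by (rule eval_comp[where ys = "[u, v]"]) (auto simp: less_Suc_eq)

lemma eval_comp3:
  "eval g xs u \<Longrightarrow> eval h xs v \<Longrightarrow> eval k xs w \<Longrightarrow> eval f [u, v, w] y
    \<Longrightarrow> eval (Comp f [g, h, k]) xs y"
  by (rule eval_comp[where ys = "[u, v, w]"]) (auto simp: less_Suc_eq)

lemma eval_prim:
  assumes "eval f xs b" and "\<And>i z. eval g (z # i # xs) (h z i)"
  shows "eval (Prim f g) (n # xs) (rec_nat b (\<lambda>i z. h z i) n)"
  by (induction n) (auto intro: eval_prim0 eval_primS assms)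

lemma eval_projI: "i < length xs \<Longrightarrow> y = xs ! i \<Longrightarrow> eval (Proj i) xs y"
  using eval_proj by blast

lemma computable1_comp: "computable1 f \<Longrightarrow> computable1 g \<Longrightarrow> computable1 (\<lambda>a. f (g a))"
  unfolding computable1_def by (meson eval_comp1)

lemma computable1_comp2:
  "computable2 F \<Longrightarrow> computable1 f \<Longrightarrow> computable1 g \<Longrightarrow> computable1 (\<lambda>a. F (f a) (g a))"
  unfolding computable1_def computable2_def by (meson eval_comp2)

lemma computable1_comp3:
  "computable3 F \<Longrightarrow> computable1 f \<Longrightarrow> computable1 g \<Longrightarrow> computable1 h
    \<Longrightarrow> computable1 (\<lambda>a. F (f a) (g a) (h a))"
  unfolding computable1_def computable3_def by (meson eval_comp3)

lemma computable2_comp1: "computable1 F \<Longrightarrow> computable2 f \<Longrightarrow> computable2 (\<lambda>a b. F (f a b))"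
  unfolding computable1_def computable2_def by (meson eval_comp1)

lemma computable2_comp2:
  "computable2 F \<Longrightarrow> computable2 f \<Longrightarrow> computable2 g \<Longrightarrow> computable2 (\<lambda>a b. F (f a b) (g a b))"
  unfolding computable2_def by (meson eval_comp2)

lemma computable1_id: "computable1 (\<lambda>a. a)"
  unfolding computable1_def by (rule exI[of _ "Proj 0"]) (auto intro: eval_projI)

lemma computable2_fst: "computable2 (\<lambda>a b. a)"
  unfolding computable2_def by (rule exI[of _ "Proj 0"]) (auto intro: eval_projI)

lemma computable2_snd: "computable2 (\<lambda>a b. b)"
  unfolding computable2_def by (rule exI[of _ "Proj 1"]) (auto intro: eval_projI)

lemma computable1_suc: "computable1 Suc"
  unfolding computable1_def by (rule exI[of _ Succ]) (auto intro: eval_succ)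

lemma computable1_const: "computable1 (\<lambda>a. c)"
proof (induction c)
  case 0
  show ?case unfolding computable1_def by (rule exI[of _ Zero]) (auto intro: eval_zero)
next
  case (Suc c)
  show ?case using computable1_comp[OF computable1_suc Suc] .
qed

lemma computable2_const: "computable2 (\<lambda>a b. c)"
  using computable2_comp1[OF computable1_const computable2_fst] .

text \<open>The step function takes the previous value first and the counter second, the order in
  which \<open>Prim\<close> supplies them. No parameter remains, so the base value comes from
  \<open>Zero\<close> on the empty list.\<close>

lemma computable1_rec: "computable2 h \<Longrightarrow> computable1 (\<lambda>n. rec_nat 0 (\<lambda>i z. h z i) n)"
proof -
  assume "computable2 h"
  then obtain p where "\<And>a b. eval p [a, b] (h a b)" unfolding computable2_def by blast
  then have "eval (Prim Zero p) [n] (rec_nat 0 (\<lambda>i z. h z i) n)" for n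
    by (intro eval_prim eval_zero) auto
  then show ?thesis unfolding computable1_def by blast
qed

lemma computable2_rec:
  "computable1 f \<Longrightarrow> computable2 h \<Longrightarrow> computable2 (\<lambda>n x. rec_nat (f x) (\<lambda>i z. h z x) n)"
proof -
  assume "computable1 f" "computable2 h"
  then obtain p q where p: "\<And>a. eval p [a] (f a)" and q: "\<And>a b. eval q [a, b] (h a b)"
    unfolding computable1_def computable2_def by blast
  have "eval (Prim p (Comp q [Proj 0, Proj 2])) [n, x] (rec_nat (f x) (\<lambda>i z. h z x) n)" for n x
    by (rule eval_prim[where h = "\<lambda>z i. h z x"])
      (auto intro!: p eval_comp2[OF eval_projI eval_projI q])
  then show ?thesis unfolding computable2_def by blast
qed

lemma computable2_add: "computable2 (+)"
proof -
  have "rec_nat x (\<lambda>i. Suc) n = n + x" for n x :: nat by (induction n) auto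
  then show ?thesis
    using computable2_rec[OF computable1_id computable2_comp1[OF computable1_suc computable2_fst]]
    by simp
qed

lemma computable2_sub: "computable2 (-)"
proof -
  \<comment> \<open>The predecessor is the recursion whose step returns its counter; iterating it
    gives truncated subtraction.\<close>
  have "rec_nat (0::nat) (\<lambda>i z. i) n = n - 1" for n by (cases n) auto
  with computable1_rec[OF computable2_snd] have pred: "computable1 (\<lambda>n. n - 1)"
    by simp
  have "rec_nat x (\<lambda>i z. z - 1) n = x - n" for x n :: nat by (induction n) auto
  with computable2_rec[OF computable1_id computable2_comp1[OF pred computable2_fst]]
  have "computable2 (\<lambda>n x. x - n)" by simp
  from computable2_comp2[OF this computable2_snd computable2_fst] show ?thesis .
qed

lemma computable2_mult: "computable2 times"
proof -
  have "rec_nat 0 (\<lambda>i z. z + x) n = n * x" for n x :: nat by (induction n) auto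
  with computable2_rec[OF computable1_const[of 0] computable2_add] show ?thesis by simp
qed

lemma computable1_triangle: "computable1 triangle"
proof -
  have "rec_nat 0 (\<lambda>i z. z + Suc i) n = triangle n" for n by (induction n) auto
  with computable1_rec[OF computable2_comp2[OF computable2_add computable2_fst
        computable2_comp1[OF computable1_suc computable2_snd]]]
  show ?thesis by simp
qed

lemma computable2_prod_encode: "computable2 pr"
proof -
  have "computable2 (\<lambda>m n. triangle (m + n) + m)"
    by (intro computable2_comp2[OF computable2_add] computable2_comp1[OF computable1_triangle]
        computable2_add computable2_fst)
  then show ?thesis by (simp add: prod_encode_def)
qed

text \<open>The index of the Cantor diagonal containing \<open>k\<close>: the largest
  \<open>t\<close> with \<open>triangle t \<le> k\<close>. The truncated inner difference vanishes
  exactly when \<open>Suc k\<close> reaches the next triangular number, and then the index grows by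
  one.\<close>

primrec triangle_root :: "nat \<Rightarrow> nat" where
  "triangle_root 0 = 0"
| "triangle_root (Suc k) =
     triangle_root k + (1 - (triangle (Suc (triangle_root k)) - Suc k))"

lemma triangle_root_bounds:
  "triangle (triangle_root k) \<le> k \<and> k < triangle (Suc (triangle_root k))"
proof (induction k)
  case (Suc k)
  then show ?case
    by (cases "triangle (Suc (triangle_root k)) \<le> Suc k") (auto simp: Suc_diff_le)
qed auto

lemma prod_decode_triangle_root:
  "prod_decode k = (k - triangle (triangle_root k), triangle_root k - (k - triangle (triangle_root k)))"
proof -
  have "prod_encode (k - triangle (triangle_root k),
      triangle_root k - (k - triangle (triangle_root k))) = k"
    using triangle_root_bounds[of k] by (auto simp: prod_encode_def)
  then show ?thesis by (metis prod_encode_inverse)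
qed

lemma computable1_triangle_root: "computable1 triangle_root"
proof -
  have "computable2 (\<lambda>z i. z + (1 - (triangle (Suc z) - Suc i)))"
    by (intro computable2_comp2[OF computable2_add] computable2_comp2[OF computable2_sub]
        computable2_comp1[OF computable1_triangle] computable2_comp1[OF computable1_suc]
        computable2_fst computable2_snd computable2_const)
  from computable1_rec[OF this]
  have "computable1 (\<lambda>n. rec_nat 0 (\<lambda>i z. z + (1 - (triangle (Suc z) - Suc i))) n)" .
  moreover have "rec_nat 0 (\<lambda>i z. z + (1 - (triangle (Suc z) - Suc i))) n = triangle_root n" for n
    by (induction n) auto
  ultimately show ?thesis by simp
qed

lemmas computable1_Suc = computable1_comp[OF computable1_suc]
lemmas computable1_add = computable1_comp2[OF computable2_add]
lemmas computable1_diff = computable1_comp2[OF computable2_sub]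
lemmas computable1_mult = computable1_comp2[OF computable2_mult]
lemmas computable1_pr = computable1_comp2[OF computable2_prod_encode]

lemma computable1_fst: "computable1 f \<Longrightarrow> computable1 (\<lambda>a. pfst (f a))"
  unfolding prod_decode_triangle_root fst_conv
  by (intro computable1_diff computable1_comp[OF computable1_triangle]
      computable1_comp[OF computable1_triangle_root])

lemma computable1_snd: "computable1 f \<Longrightarrow> computable1 (\<lambda>a. psnd (f a))"
  unfolding prod_decode_triangle_root snd_conv
  by (intro computable1_diff computable1_comp[OF computable1_triangle]
      computable1_comp[OF computable1_triangle_root])

text \<open>From here on several arguments are packed into one code, so that closure properties are
  needed for one arity only. The step function reads the code of counter, previous value and
  parameter.\<close>

lemma computable1_prim:
  assumes "computable1 F" and "computable1 N"
    and H: "computable1 (\<lambda>b. H (pfst b) (pfst (psnd b)) (psnd (psnd b)))"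
  shows "computable1 (\<lambda>a. rec_nat (F a) (\<lambda>i z. H i z a) (N a))"
proof -
  obtain pF pN pH pp where F: "\<And>a. eval pF [a] (F a)" and N: "\<And>a. eval pN [a] (N a)"
    and pH: "\<And>b. eval pH [b] (H (pfst b) (pfst (psnd b)) (psnd (psnd b)))"
    and pp: "\<And>a b. eval pp [a, b] (pr a b)"
    using assms computable2_prod_encode unfolding computable1_def computable2_def by metis
  let ?g = "Comp pH [Comp pp [Proj 1, Comp pp [Proj 0, Proj 2]]]"
  have g: "eval ?g [z, i, a] (H i z a)" for z i a
  proof -
    have "eval (Comp pp [Proj 1, Comp pp [Proj 0, Proj 2]]) [z, i, a] (pr i (pr z a))"
      by (rule eval_comp2[OF eval_projI eval_comp2[OF eval_projI eval_projI pp] pp]) auto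
    from eval_comp1[OF this pH] show ?thesis by simp
  qed
  have "eval (Comp (Prim pF ?g) [pN, Proj 0]) [a] (rec_nat (F a) (\<lambda>i z. H i z a) (N a))" for a
    by (rule eval_comp2[OF N eval_projI eval_prim[OF F g]]) auto
  then show ?thesis unfolding computable1_def by blast
qed

section \<open>Bounded sums and products, and unbounded search\<close>

lemma computable1_sum:
  assumes "computable1 N" and "computable1 (\<lambda>b. h (pfst b) (psnd b))"
  shows "computable1 (\<lambda>a. \<Sum>i<N a. h i a)"
proof -
  have "rec_nat 0 (\<lambda>i z. z + h i a) n = (\<Sum>i<n. h i a)" for n a by (induction n) auto
  moreover have "computable1 (\<lambda>a. rec_nat 0 (\<lambda>i z. z + h i a) (N a))"
    using computable1_comp[OF assms(2), of "\<lambda>b. pr (pfst b) (psnd (psnd b))"]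
    by (intro computable1_prim computable1_const assms computable1_add computable1_fst computable1_snd
        computable1_id) (simp add: computable1_pr computable1_fst computable1_snd computable1_id)
  ultimately show ?thesis by simp
qed

lemma computable1_prod:
  assumes "computable1 N" and "computable1 (\<lambda>b. h (pfst b) (psnd b))"
  shows "computable1 (\<lambda>a. \<Prod>i<N a. h i a)"
proof -
  have "rec_nat 1 (\<lambda>i z. z * h i a) n = (\<Prod>i<n. h i a)" for n a by (induction n) auto
  moreover have "computable1 (\<lambda>a. rec_nat 1 (\<lambda>i z. z * h i a) (N a))"
    using computable1_comp[OF assms(2), of "\<lambda>b. pr (pfst b) (psnd (psnd b))"]
    by (intro computable1_prim computable1_const assms computable1_mult computable1_fst computable1_snd
        computable1_id) (simp add: computable1_pr computable1_fst computable1_snd computable1_id)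
  ultimately show ?thesis by simp
qed

lemma computable1_power2: "computable1 f \<Longrightarrow> computable1 (\<lambda>a. 2 ^ f a)"
  using computable1_prod[of f "\<lambda>i a. 2"] by (simp add: computable1_const)

text \<open>\<open>Mn\<close> requires defined positive values below the minimum. They are defined
  because \<open>g\<close> is total, and positive by minimality.\<close>

lemma computable1_minimization:
  assumes "computable1 g" and ex: "\<And>a. \<exists>s. g (pr s a) = 0"
  shows "computable1 (\<lambda>a. LEAST s. g (pr s a) = 0)"
proof -
  obtain pg pp where pg: "\<And>a. eval pg [a] (g a)" and pp: "\<And>a b. eval pp [a, b] (pr a b)"
    using assms computable2_prod_encode unfolding computable1_def computable2_def by metis
  have e: "eval (Comp pg [pp]) [s, a] (g (pr s a))" for s a
    by (rule eval_comp1[OF pp pg])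
  have "eval (Mn (Comp pg [pp])) [a] (LEAST s. g (pr s a) = 0)" for a
  proof (rule eval_mn)
    show "eval (Comp pg [pp]) [LEAST s. g (pr s a) = 0, a] 0"
      using e[of "LEAST s. g (pr s a) = 0" a] LeastI_ex[OF ex[of a]] by simp
    show "\<forall>m<LEAST s. g (pr s a) = 0. \<exists>k. eval (Comp pg [pp]) [m, a] (Suc k)"
    proof (intro allI impI)
      fix m assume "m < (LEAST s. g (pr s a) = 0)"
      then have "g (pr m a) \<noteq> 0" by (rule not_less_Least)
      then show "\<exists>k. eval (Comp pg [pp]) [m, a] (Suc k)"
        using e[of m a] by (cases "g (pr m a)") auto
    qed
  qed
  then show ?thesis unfolding computable1_def by blast
qed

section \<open>Semidecidable predicates\<close>

text \<open>A projection of a decidable relation, with \<open>s\<close> as the witness to search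
  for. Coding truth by zero turns conjunction into a sum and disjunction into a product, and spares
  the parallel simulation of partial programs.\<close>

definition semidecidable :: "(nat \<Rightarrow> bool) \<Rightarrow> bool" where
  "semidecidable P \<longleftrightarrow> (\<exists>g. computable1 g \<and> (\<forall>a. P a \<longleftrightarrow> (\<exists>s. g (pr s a) = 0)))"

lemmas computable1_basic = computable1_id computable1_const computable1_Suc computable1_add
  computable1_diff computable1_mult computable1_pr computable1_fst computable1_snd

lemma semidecidable_zero: "computable1 h \<Longrightarrow> semidecidable (\<lambda>a. h a = 0)"
  unfolding semidecidable_def
  by (rule exI[of _ "\<lambda>b. h (psnd b)"])
    (auto intro!: computable1_comp[of h psnd] computable1_snd computable1_id)

lemma semidecidable_comp:
  assumes "semidecidable P" and "computable1 f"
  shows "semidecidable (\<lambda>a. P (f a))"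
proof -
  obtain g where g: "computable1 g" "\<And>a. P a \<longleftrightarrow> (\<exists>s. g (pr s a) = 0)"
    using assms unfolding semidecidable_def by blast
  have "computable1 (\<lambda>b. g (pr (pfst b) (f (psnd b))))"
    by (intro computable1_comp[OF g(1)] computable1_comp[OF assms(2)] computable1_basic)
  then show ?thesis
    unfolding semidecidable_def using g(2)
    by (intro exI[of _ "\<lambda>b. g (pr (pfst b) (f (psnd b)))"]) simp
qed

lemma semidecidable_conj:
  assumes "semidecidable P" and "semidecidable Q"
  shows "semidecidable (\<lambda>a. P a \<and> Q a)"
proof -
  obtain g h where g: "computable1 g" "\<And>a. P a \<longleftrightarrow> (\<exists>s. g (pr s a) = 0)"
    and h: "computable1 h" "\<And>a. Q a \<longleftrightarrow> (\<exists>s. h (pr s a) = 0)"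
    using assms unfolding semidecidable_def by metis
  let ?k = "\<lambda>b. g (pr (pfst (pfst b)) (psnd b)) + h (pr (psnd (pfst b)) (psnd b))"
  have "computable1 ?k"
    by (intro computable1_add computable1_comp[OF g(1)] computable1_comp[OF h(1)] computable1_basic)
  moreover have "P a \<and> Q a \<longleftrightarrow> (\<exists>s. ?k (pr s a) = 0)" for a
  proof
    assume "P a \<and> Q a"
    then obtain s t where "g (pr s a) = 0" "h (pr t a) = 0" using g h by blast
    then show "\<exists>s. ?k (pr s a) = 0" by (intro exI[of _ "pr s t"]) simp
  qed (use g h in auto)
  ultimately show ?thesis unfolding semidecidable_def by (intro exI[of _ ?k]) blast
qed

lemma semidecidable_disj:
  assumes "semidecidable P" and "semidecidable Q"
  shows "semidecidable (\<lambda>a. P a \<or> Q a)"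
proof -
  obtain g h where g: "computable1 g" "\<And>a. P a \<longleftrightarrow> (\<exists>s. g (pr s a) = 0)"
    and h: "computable1 h" "\<And>a. Q a \<longleftrightarrow> (\<exists>s. h (pr s a) = 0)"
    using assms unfolding semidecidable_def by metis
  have "computable1 (\<lambda>b. g b * h b)" by (intro computable1_mult g h)
  moreover have "P a \<or> Q a \<longleftrightarrow> (\<exists>s. g (pr s a) * h (pr s a) = 0)" for a
    using g h by auto
  ultimately show ?thesis
    unfolding semidecidable_def by (intro exI[of _ "\<lambda>b. g b * h b"]) blast
qed

lemma semidecidable_ex:
  assumes "semidecidable (\<lambda>b. P (pfst b) (psnd b))"
  shows "semidecidable (\<lambda>a. \<exists>i. P i a)"
proof -
  obtain g where g: "computable1 g" "\<And>b. P (pfst b) (psnd b) \<longleftrightarrow> (\<exists>s. g (pr s b) = 0)"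
    using assms unfolding semidecidable_def by metis
  let ?k = "\<lambda>b. g (pr (pfst (pfst b)) (pr (psnd (pfst b)) (psnd b)))"
  have "computable1 ?k" by (intro computable1_comp[OF g(1)] computable1_basic)
  moreover have "(\<exists>i. P i a) \<longleftrightarrow> (\<exists>s. ?k (pr s a) = 0)" for a
  proof
    assume "\<exists>i. P i a"
    then obtain i s where "g (pr s (pr i a)) = 0" using g(2)[of "pr i a" for i] by auto
    then show "\<exists>s. ?k (pr s a) = 0" by (intro exI[of _ "pr s i"]) simp
  next
    assume "\<exists>s. ?k (pr s a) = 0"
    then obtain s where "g (pr (pfst s) (pr (psnd s) a)) = 0" by auto
    then show "\<exists>i. P i a" using g(2)[of "pr (psnd s) a"] by auto
  qed
  ultimately show ?thesis unfolding semidecidable_def by (intro exI[of _ ?k]) blast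
qed

lemma semidecidable_all_less:
  assumes "semidecidable (\<lambda>b. P (pfst b) (psnd b))" and "computable1 N"
  shows "semidecidable (\<lambda>a. \<forall>i<N a. P i a)"
proof -
  obtain g where g: "computable1 g" "\<And>b. P (pfst b) (psnd b) \<longleftrightarrow> (\<exists>s. g (pr s b) = 0)"
    using assms unfolding semidecidable_def by metis
  have gP: "P i a \<longleftrightarrow> (\<exists>s. g (pr s (pr i a)) = 0)" for i a
    using g(2)[of "pr i a"] by simp
  \<comment> \<open>The product vanishes when some witness for \<open>i\<close> lies below the
    bound, so one number bounding all witnesses serves every \<open>i\<close>. The successor of the
    sum of the witnesses is such a bound.\<close>
  let ?k = "\<lambda>b. \<Sum>i<N (psnd b). \<Prod>s<pfst b. g (pr s (pr i (psnd b)))"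
  have "computable1 ?k"
    by (intro computable1_sum computable1_prod computable1_comp[OF g(1)]
        computable1_comp[OF assms(2)] computable1_basic)
  moreover have "(\<forall>i<N a. P i a) \<longleftrightarrow> (\<exists>t. ?k (pr t a) = 0)" for a
  proof
    assume "\<forall>i<N a. P i a"
    then have "\<forall>i. \<exists>s. i < N a \<longrightarrow> g (pr s (pr i a)) = 0" using gP by blast
    then obtain s where s: "\<And>i. i < N a \<Longrightarrow> g (pr (s i) (pr i a)) = 0" by metis
    have "(\<Prod>u<Suc (\<Sum>i<N a. s i). g (pr u (pr i a))) = 0" if "i < N a" for i
      using s[OF that] member_le_sum[of i "{..<N a}" s] that
      by (intro prod_zero bexI[of _ "s i"]) auto
    then show "\<exists>t. ?k (pr t a) = 0"
      by (intro exI[of _ "Suc (\<Sum>i<N a. s i)"]) simp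
  next
    assume "\<exists>t. ?k (pr t a) = 0"
    then obtain t where "\<forall>i<N a. (\<Prod>s<t. g (pr s (pr i a))) = 0" by auto
    then show "\<forall>i<N a. P i a" using gP by fastforce
  qed
  ultimately show ?thesis unfolding semidecidable_def by (intro exI[of _ ?k]) blast
qed

lemma semidecidable_const: "semidecidable (\<lambda>a. c)"
  using semidecidable_zero[OF computable1_const[of "if c then 0 else 1"]] by (cases c) auto

lemma semidecidable_finite_ball:
  "finite K \<Longrightarrow> (\<And>k. k \<in> K \<Longrightarrow> semidecidable (P k)) \<Longrightarrow> semidecidable (\<lambda>a. \<forall>k\<in>K. P k a)"
  by (induction K rule: finite_induct) (auto intro: semidecidable_const semidecidable_conj)

lemma semidecidable_finite_bex:
  "finite K \<Longrightarrow> (\<And>k. k \<in> K \<Longrightarrow> semidecidable (P k)) \<Longrightarrow> semidecidable (\<lambda>a. \<exists>k\<in>K. P k a)"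
  by (induction K rule: finite_induct) (auto intro: semidecidable_const semidecidable_disj)

lemma semidecidable_le: "computable1 f \<Longrightarrow> computable1 g \<Longrightarrow> semidecidable (\<lambda>a. f a \<le> g a)"
  using semidecidable_zero[OF computable1_diff, of f g] by simp

lemma semidecidable_less: "computable1 f \<Longrightarrow> computable1 g \<Longrightarrow> semidecidable (\<lambda>a. f a < g a)"
  using semidecidable_le[OF computable1_Suc, of f g] by (simp add: Suc_le_eq)

lemma semidecidable_eq: "computable1 f \<Longrightarrow> computable1 g \<Longrightarrow> semidecidable (\<lambda>a. f a = g a)"
  using semidecidable_conj[OF semidecidable_le semidecidable_le, of f g g f] by (simp add: eq_iff)

lemma semidecidable_neq: "computable1 f \<Longrightarrow> computable1 g \<Longrightarrow> semidecidable (\<lambda>a. f a \<noteq> g a)"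
  using semidecidable_disj[OF semidecidable_less semidecidable_less, of f g g f]
  by (simp add: neq_iff)

text \<open>The search runs over codes of a candidate \<open>j\<close> together with a witness for
  \<open>R k j\<close>, since the relation itself need not be decidable; \<open>j\<close> is then
  read off the first success.\<close>

lemma semidecidable_selection:
  assumes "semidecidable (\<lambda>b. R (pfst b) (psnd b))" and "\<And>k. \<exists>j. R k j"
  shows "\<exists>f. computable1 f \<and> (\<forall>k. R k (f k))"
proof -
  obtain g where g: "computable1 g" "\<And>b. R (pfst b) (psnd b) \<longleftrightarrow> (\<exists>s. g (pr s b) = 0)"
    using assms unfolding semidecidable_def by metis
  have gR: "R k j \<longleftrightarrow> (\<exists>s. g (pr s (pr k j)) = 0)" for k j using g(2)[of "pr k j"] by simp
  let ?h = "\<lambda>b. g (pr (pfst (pfst b)) (pr (psnd b) (psnd (pfst b))))"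
  have h: "computable1 ?h" by (intro computable1_comp[OF g(1)] computable1_basic)
  have ex: "\<exists>t. ?h (pr t k) = 0" for k
  proof -
    obtain j s where "g (pr s (pr k j)) = 0" using assms(2)[of k] gR by blast
    then show ?thesis by (intro exI[of _ "pr s j"]) simp
  qed
  let ?f = "\<lambda>k. LEAST t. ?h (pr t k) = 0"
  have "computable1 (\<lambda>k. psnd (?f k))"
    by (intro computable1_snd computable1_minimization h ex)
  moreover have "R k (psnd (?f k))" for k
    using LeastI_ex[OF ex[of k]] gR by auto
  ultimately show ?thesis by (intro exI[of _ "\<lambda>k. psnd (?f k)"]) blast
qed

section \<open>Codes of lists\<close>

text \<open>A nonempty list is coded by the successor of a pair, hence the \<open>c - 1\<close>.
  Truncated subtraction sends the code 0 of the empty list to itself, in agreement with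
  \<open>tl\<close>.\<close>

abbreviation tl_code :: "nat \<Rightarrow> nat" where
  "tl_code c \<equiv> psnd (c - 1)"

abbreviation hd_code :: "nat \<Rightarrow> nat" where
  "hd_code c \<equiv> pfst (c - 1)"

definition drop_code :: "nat \<Rightarrow> nat \<Rightarrow> nat" where
  "drop_code i c = rec_nat c (\<lambda>_. tl_code) i"

definition nth_code :: "nat \<Rightarrow> nat \<Rightarrow> nat" where
  "nth_code c i = hd_code (drop_code i c)"

lemma list_decode_nonzero: "c \<noteq> 0 \<Longrightarrow> list_decode c = hd_code c # list_decode (tl_code c)"
  by (cases c) (auto split: prod.splits)

lemma list_decode_tl_code: "list_decode (tl_code c) = tl (list_decode c)"
  by (cases "c = 0") (auto simp: list_decode_nonzero prod_decode_triangle_root)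

lemma list_decode_drop_code: "list_decode (drop_code i c) = drop i (list_decode c)"
proof (induction i)
  case (Suc i)
  have "drop_code (Suc i) c = tl_code (drop_code i c)" by (simp add: drop_code_def)
  then show ?case by (simp only: list_decode_tl_code Suc drop_Suc tl_drop)
qed (simp add: drop_code_def)

lemma list_decode_eq_Nil: "list_decode c = [] \<longleftrightarrow> c = 0"
  using list_decode_nonzero[of c] by fastforce

lemma drop_code_eq_0: "drop_code i c = 0 \<longleftrightarrow> length (list_decode c) \<le> i"
  using list_decode_eq_Nil[of "drop_code i c"] by (simp add: list_decode_drop_code)

lemma nth_code: "i < length (list_decode c) \<Longrightarrow> nth_code c i = list_decode c ! i"
  using list_decode_nonzero[of "drop_code i c"] drop_code_eq_0[of i c]
  by (auto simp: nth_code_def list_decode_drop_code Cons_nth_drop_Suc[symmetric])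

text \<open>This takes the place of Goedel's beta function: quantifying over finite sequences
  becomes quantifying over numbers.\<close>

lemma ex_nth_code: "\<exists>c. \<forall>i\<le>n. nth_code c i = z i"
proof -
  have "nth_code (list_encode (map z [0..<Suc n])) i = z i" if "i \<le> n" for i
    using that by (subst nth_code) (auto simp del: upt_Suc)
  then show ?thesis by blast
qed

lemma computable1_drop_code:
  "computable1 f \<Longrightarrow> computable1 g \<Longrightarrow> computable1 (\<lambda>a. drop_code (f a) (g a))"
  unfolding drop_code_def
  by (intro computable1_prim computable1_basic)

lemma computable1_nth_code:
  "computable1 f \<Longrightarrow> computable1 g \<Longrightarrow> computable1 (\<lambda>a. nth_code (f a) (g a))"
  unfolding nth_code_def by (intro computable1_basic computable1_drop_code)

section \<open>The graph of a recursive function is semidecidable\<close>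

lemma eval_Zero_iff: "eval Zero xs y \<longleftrightarrow> y = 0"
  by (auto elim: eval.cases intro: eval_zero)

lemma eval_Succ_iff: "eval Succ xs y \<longleftrightarrow> xs \<noteq> [] \<and> y = Suc (hd xs)"
  by (cases xs) (auto elim: eval.cases intro: eval_succ)

lemma eval_Proj_iff: "eval (Proj i) xs y \<longleftrightarrow> i < length xs \<and> y = xs ! i"
  by (auto elim: eval.cases intro: eval_proj)

lemma eval_Comp_iff:
  "eval (Comp f gs) xs y \<longleftrightarrow> (\<exists>ys. list_all2 (\<lambda>g. eval g xs) gs ys \<and> eval f ys y)"
proof
  show "eval (Comp f gs) xs y \<Longrightarrow> \<exists>ys. list_all2 (\<lambda>g. eval g xs) gs ys \<and> eval f ys y"
    by (erule eval.cases) (simp_all add: list_all2_conv_all_nth, metis)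
qed (auto simp: list_all2_conv_all_nth intro: eval_comp)

lemma eval_Mn_iff:
  "eval (Mn f) xs n \<longleftrightarrow> eval f (n # xs) 0 \<and> (\<forall>m<n. \<exists>k. eval f (m # xs) (Suc k))"
  by (auto elim: eval.cases intro: eval_mn)

text \<open>Here \<open>z\<close> is the whole history of the recursion. Its first
  \<open>Suc n\<close> values can be coded by one number, which makes it available as a search
  witness.\<close>

lemma eval_Prim_iff:
  "eval (Prim f g) (n # xs) y \<longleftrightarrow>
    (\<exists>z. eval f xs (z 0) \<and> (\<forall>i<n. eval g (z i # i # xs) (z (Suc i))) \<and> z n = y)"
proof
  show "eval (Prim f g) (n # xs) y \<Longrightarrow>
      \<exists>z. eval f xs (z 0) \<and> (\<forall>i<n. eval g (z i # i # xs) (z (Suc i))) \<and> z n = y"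
  proof (induction n arbitrary: y)
    case 0
    then have "eval f xs y" by (auto elim: eval.cases)
    then show ?case by auto
  next
    case (Suc n)
    from Suc.prems obtain w where "eval (Prim f g) (n # xs) w" and w: "eval g (w # n # xs) y"
      by (auto elim: eval.cases)
    with Suc.IH obtain z where z: "eval f xs (z 0)" "\<forall>i<n. eval g (z i # i # xs) (z (Suc i))" "z n = w"
      by blast
    show ?case
      by (rule exI[of _ "z(Suc n := y)"]) (use z w in \<open>auto simp: less_Suc_eq\<close>)
  qed
next
  assume "\<exists>z. eval f xs (z 0) \<and> (\<forall>i<n. eval g (z i # i # xs) (z (Suc i))) \<and> z n = y"
  then obtain z where z: "eval f xs (z 0)" "\<forall>i<n. eval g (z i # i # xs) (z (Suc i))" "z n = y"
    by blast
  have "i \<le> n \<Longrightarrow> eval (Prim f g) (i # xs) (z i)" for i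
    by (induction i) (use z in \<open>auto intro: eval_prim0 eval_primS\<close>)
  then show "eval (Prim f g) (n # xs) y" using z(3) by blast
qed

definition semidecidable_graph :: "recf \<Rightarrow> bool" where
  "semidecidable_graph p \<longleftrightarrow> semidecidable (\<lambda>b. eval p (list_decode (pfst b)) (psnd b))"

lemma semidecidable_graph_comp:
  assumes "semidecidable_graph p" and "computable1 f" and "computable1 g"
  shows "semidecidable (\<lambda>a. eval p (list_decode (f a)) (g a))"
  using semidecidable_comp[OF assms(1)[unfolded semidecidable_graph_def] computable1_pr[OF assms(2,3)]]
  by simp

lemma semidecidable_list_all2_eval:
  assumes "\<And>g. g \<in> set gs \<Longrightarrow> semidecidable_graph g" and "computable1 f" and "computable1 h"
  shows "semidecidable (\<lambda>a. list_all2 (\<lambda>g. eval g (list_decode (f a))) gs (list_decode (h a)))"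
  using assms
proof (induction gs arbitrary: h)
  case Nil
  have "list_all2 (\<lambda>g. eval g (list_decode (f a))) [] (list_decode (h a)) \<longleftrightarrow> h a = 0" for a
    by (simp add: list_decode_eq_Nil)
  then show ?case using semidecidable_zero[OF Nil(3)] by simp
next
  case (Cons g gs)
  have eq: "list_all2 (\<lambda>g. eval g (list_decode (f a))) (g # gs) (list_decode (h a)) \<longleftrightarrow>
      h a \<noteq> 0 \<and> eval g (list_decode (f a)) (hd_code (h a))
        \<and> list_all2 (\<lambda>g. eval g (list_decode (f a))) gs (list_decode (tl_code (h a)))" for a
    by (cases "h a = 0") (auto simp: list_decode_nonzero)
  show ?case unfolding eq
    by (intro semidecidable_conj semidecidable_neq computable1_basic semidecidable_graph_comp Cons) auto
qed

lemma list_decode_Suc_pr: "list_decode (Suc (pr x c)) = x # list_decode c"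
  by simp

text \<open>\<open>c_e\<close> speaks of domains of partial programs, while searches need total
  computable relations. Induction on the program connects the two, with intermediate values and
  computation histories as numerical witnesses, in place of a universal program with a step
  counter.\<close>

lemma semidecidable_graph: "semidecidable_graph p"
proof (induction p)
  case Zero
  show ?case unfolding semidecidable_graph_def eval_Zero_iff
    by (intro semidecidable_eq computable1_basic)
next
  case Succ
  have "eval Succ (list_decode c) y \<longleftrightarrow> c \<noteq> 0 \<and> y = Suc (hd_code c)" for c y
    by (cases "c = 0") (auto simp: eval_Succ_iff list_decode_nonzero)
  then show ?case unfolding semidecidable_graph_def
    by (simp only:) (intro semidecidable_conj semidecidable_eq semidecidable_neq computable1_basic)
next
  case (Proj i)
  have "eval (Proj i) (list_decode c) y \<longleftrightarrow> drop_code i c \<noteq> 0 \<and> y = nth_code c i" for c y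
    by (auto simp: eval_Proj_iff drop_code_eq_0 nth_code)
  then show ?case unfolding semidecidable_graph_def
    by (simp only:) (intro semidecidable_conj semidecidable_eq semidecidable_neq computable1_basic
        computable1_drop_code computable1_nth_code)
next
  case (Comp f gs)
  have "eval (Comp f gs) xs y \<longleftrightarrow>
      (\<exists>c. list_all2 (\<lambda>g. eval g xs) gs (list_decode c) \<and> eval f (list_decode c) y)" for xs y
    unfolding eval_Comp_iff by (metis list_encode_inverse)
  then show ?case unfolding semidecidable_graph_def
    by (simp only:) (intro semidecidable_ex semidecidable_conj semidecidable_list_all2_eval
        semidecidable_graph_comp computable1_basic Comp)
next
  case (Prim f g)
  \<comment> \<open>On the empty list, coded by 0, \<open>Prim\<close> has no value. Otherwise
    \<open>z\<close> codes the history of the recursion.\<close>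
  have eq: "eval (Prim f g) (list_decode c) y \<longleftrightarrow>
      c \<noteq> 0 \<and> (\<exists>z. eval f (list_decode (tl_code c)) (nth_code z 0) \<and>
        (\<forall>i<hd_code c. eval g (list_decode (Suc (pr (nth_code z i) (Suc (pr i (tl_code c))))))
            (nth_code z (Suc i))) \<and> nth_code z (hd_code c) = y)" (is "?l \<longleftrightarrow> c \<noteq> 0 \<and> ?r") for c y
  proof (cases "c = 0")
    case True
    then show ?thesis by (auto elim: eval.cases)
  next
    case False
    let ?n = "hd_code c" and ?xs = "list_decode (tl_code c)"
    have "?l \<longleftrightarrow> eval (Prim f g) (?n # ?xs) y" using list_decode_nonzero[OF False] by simp
    also have "\<dots> \<longleftrightarrow> ?r"
    proof
      assume "eval (Prim f g) (?n # ?xs) y"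
      then obtain z where z: "eval f ?xs (z 0)" "\<forall>i<?n. eval g (z i # i # ?xs) (z (Suc i))" "z ?n = y"
        unfolding eval_Prim_iff by blast
      obtain w where "\<forall>i\<le>?n. nth_code w i = z i" using ex_nth_code by blast
      with z show ?r by (intro exI[of _ w]) (auto simp: list_decode_Suc_pr)
    next
      assume ?r
      then obtain z where z: "eval f ?xs (nth_code z 0)"
        "\<forall>i<?n. eval g (nth_code z i # i # ?xs) (nth_code z (Suc i))" "nth_code z ?n = y"
        by (auto simp: list_decode_Suc_pr)
      then show "eval (Prim f g) (?n # ?xs) y" unfolding eval_Prim_iff by blast
    qed
    finally show ?thesis using False by blast
  qed
  show ?case unfolding semidecidable_graph_def eq
    by (intro semidecidable_ex semidecidable_conj semidecidable_all_less semidecidable_neq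
        semidecidable_eq semidecidable_graph_comp Prim computable1_basic computable1_nth_code)
next
  case (Mn f)
  have eq: "eval (Mn f) (list_decode c) n \<longleftrightarrow> eval f (list_decode (Suc (pr n c))) 0 \<and>
      (\<forall>m<n. \<exists>k. eval f (list_decode (Suc (pr m c))) (Suc k))" for c n
    by (simp add: eval_Mn_iff)
  show ?case unfolding semidecidable_graph_def eq
    by (intro semidecidable_ex semidecidable_conj semidecidable_all_less
        semidecidable_graph_comp Mn computable1_basic)
qed

lemma semidecidable_c_e: "c_e A \<Longrightarrow> semidecidable (\<lambda>a. a \<in> A)"
proof -
  assume "c_e A"
  then obtain p where "\<And>a. a \<in> A \<longleftrightarrow> (\<exists>y. eval p [a] y)" unfolding c_e_def by blast
  then have eq: "a \<in> A \<longleftrightarrow> (\<exists>y. eval p (list_decode (Suc (pr a 0))) y)" for a by simp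
  show ?thesis unfolding eq
    by (intro semidecidable_ex semidecidable_graph_comp semidecidable_graph computable1_basic)
qed

section \<open>Computable sequences of rationals\<close>

lemma rat_code_pr: "rat_code (pr a (pr b c)) = (real a - real b) / (real c + 1)"
  by (simp add: rat_code_def)

lemma rat_code_fields:
  "rat_code n = (real (pfst n) - real (pfst (psnd n))) / (real (psnd (psnd n)) + 1)"
  by (simp add: rat_code_def case_prod_beta)

lemma computable_rat1_comp: "computable_rat1 f \<Longrightarrow> computable1 g \<Longrightarrow> computable_rat1 (\<lambda>a. f (g a))"
  unfolding computable_rat1_def using computable1_comp by blast

lemma computable_rat1_code: "computable1 c \<Longrightarrow> computable_rat1 (\<lambda>a. rat_code (c a))"
  unfolding computable_rat1_def by blast

lemma computable_rat1_add:
  assumes "computable_rat1 f" and "computable_rat1 g"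
  shows "computable_rat1 (\<lambda>a. f a + g a)"
proof -
  obtain c d where c: "computable1 c" "\<And>i. f i = rat_code (c i)"
    and d: "computable1 d" "\<And>i. g i = rat_code (d i)"
    using assms unfolding computable_rat1_def by metis
  define N where "N a = psnd (psnd a)" for a
  \<comment> \<open>A code stores the denominator minus one, hence the \<open>Suc\<close> in the
    factors and the final \<open>- 1\<close>.\<close>
  define h where "h a = pr (pfst (c a) * Suc (N (d a)) + pfst (d a) * Suc (N (c a)))
    (pr (pfst (psnd (c a)) * Suc (N (d a)) + pfst (psnd (d a)) * Suc (N (c a)))
        (Suc (N (c a)) * Suc (N (d a)) - 1))" for a
  have "computable1 h" unfolding h_def N_def
    by (intro computable1_basic c d)
  moreover have "f a + g a = rat_code (h a)" for a
    unfolding c d h_def rat_code_pr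
    by (simp add: rat_code_fields N_def[symmetric] field_simps add_divide_distrib)
  ultimately show ?thesis unfolding computable_rat1_def by blast
qed

lemma computable_rat1_half_power: "computable1 f \<Longrightarrow> computable_rat1 (\<lambda>a. (1/2) ^ f a)"
proof -
  assume f: "computable1 f"
  have "(1/2) ^ m = rat_code (pr 1 (pr 0 (2 ^ m - 1)))" for m
    by (simp add: rat_code_pr of_nat_diff power_divide)
  moreover have "computable1 (\<lambda>a. pr 1 (pr 0 (2 ^ f a - 1)))"
    by (intro computable1_basic computable1_power2 f)
  ultimately show ?thesis
    unfolding computable_rat1_def by (intro exI[of _ "\<lambda>a. pr 1 (pr 0 (2 ^ f a - 1))"]) auto
qed

text \<open>The denominators are positive and the subtracted parts change sides, which leaves a
  comparison of natural numbers.\<close>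

lemma fraction_less_iff:
  "(real a - real b) / (real c + 1) < (real a' - real b') / (real c' + 1) \<longleftrightarrow>
    a * Suc c' + b' * Suc c < a' * Suc c + b * Suc c'"
proof -
  have "(real a - real b) / (real c + 1) < (real a' - real b') / (real c' + 1) \<longleftrightarrow>
      (real a - real b) * (real c' + 1) < (real a' - real b') * (real c + 1)"
    using frac_less_eq[of "real c + 1" "real c' + 1"] by (simp add: divide_less_eq less_divide_eq mult.commute)
  also have "\<dots> \<longleftrightarrow> real (a * Suc c' + b' * Suc c) < real (a' * Suc c + b * Suc c')"
    by (simp add: algebra_simps)
  finally show ?thesis unfolding of_nat_less_iff .
qed

lemma semidecidable_rat_less:
  assumes "computable_rat1 f" and "computable_rat1 g"
  shows "semidecidable (\<lambda>a. f a < g a)"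
proof -
  obtain c d where c: "computable1 c" "\<And>i. f i = rat_code (c i)"
    and d: "computable1 d" "\<And>i. g i = rat_code (d i)"
    using assms unfolding computable_rat1_def by metis
  have "rat_code m < rat_code n \<longleftrightarrow>
      pfst m * Suc (psnd (psnd n)) + pfst (psnd n) * Suc (psnd (psnd m))
        < pfst n * Suc (psnd (psnd m)) + pfst (psnd m) * Suc (psnd (psnd n))" for m n
    unfolding rat_code_fields by (rule fraction_less_iff)
  then show ?thesis unfolding c d
    by (simp only:) (intro semidecidable_less computable1_basic c d)
qed

section \<open>A cube is not covered by pairs of disjoint open sets avoiding opposite faces\<close>

lemma tendsto_funI:
  fixes f :: "'b \<Rightarrow> 'i \<Rightarrow> 'a::topological_space"
  assumes "\<And>i. ((\<lambda>n. f n i) \<longlongrightarrow> l i) F"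
  shows "(f \<longlongrightarrow> l) F"
proof -
  have "limitin (product_topology (\<lambda>i. euclidean) UNIV) f l F"
    using assms by (simp add: limitin_componentwise)
  then show ?thesis by (simp add: euclidean_product_topology)
qed

lemma compact_function_interval: "compact {lo..hi :: 'i \<Rightarrow> real}"
proof -
  have "compactin (product_topology (\<lambda>i. euclidean) UNIV) (PiE UNIV (\<lambda>i. {lo i..hi i}))"
    by (simp add: compactin_PiE)
  moreover have "PiE UNIV (\<lambda>i. {lo i..hi i}) = {lo..hi}"
    by (auto simp: PiE_def Pi_def le_fun_def)
  ultimately show ?thesis by (simp add: euclidean_product_topology)
qed

text \<open>A covering form of the Poincare-Miranda theorem. If the pairs covered the cube,
  membership in \<open>U k\<close> or \<open>V k\<close> would label the vertices of ever finer
  grids. Kuhn's lemma gives cells on which each label takes both values, and these accumulate at a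
  point that no pair can contain.\<close>

lemma kuhn_cover:
  fixes F :: "(nat \<Rightarrow> real) \<Rightarrow> 'a::topological_space"
  assumes le: "lo \<le> hi" and degenerate: "\<And>i. i \<notin> {1..n} \<Longrightarrow> lo i = hi i"
    and cont: "continuous_on {lo..hi} F"
    and open_U: "\<And>k. k \<in> {1..n} \<Longrightarrow> open (U k)" and open_V: "\<And>k. k \<in> {1..n} \<Longrightarrow> open (V k)"
    and disj: "\<And>k. k \<in> {1..n} \<Longrightarrow> U k \<inter> V k = {}"
    and hi_face: "\<And>k y. k \<in> {1..n} \<Longrightarrow> y \<in> {lo..hi} \<Longrightarrow> y k = hi k \<Longrightarrow> F y \<notin> U k"
    and lo_face: "\<And>k y. k \<in> {1..n} \<Longrightarrow> y \<in> {lo..hi} \<Longrightarrow> y k = lo k \<Longrightarrow> F y \<notin> V k"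
  shows "\<exists>y\<in>{lo..hi}. \<forall>k\<in>{1..n}. F y \<notin> U k \<union> V k"
proof (rule ccontr)
  assume "\<not> ?thesis"
  then have cover: "\<exists>k\<in>{1..n}. F y \<in> U k \<union> V k" if "y \<in> {lo..hi}" for y
    using that by blast
  \<comment> \<open>Kuhn's lemma numbers coordinates from 0, the cube from 1; hence
    \<open>j - 1\<close>. In degenerate coordinates the factor \<open>hi j - lo j\<close> is 0,
    whatever \<open>r\<close> contributes.\<close>
  define grid where "grid p r j = lo j + (hi j - lo j) * (real (r (j - 1)) / real p)"
    for p :: nat and r :: "nat \<Rightarrow> nat" and j
  have lohi: "lo j \<le> hi j" for j using le by (simp add: le_fun_def)
  have grid_in: "grid p r \<in> {lo..hi}" if "0 < p" "\<forall>i<n. r i \<le> p" for p r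
  proof -
    have "lo j \<le> grid p r j \<and> grid p r j \<le> hi j" for j
    proof (cases "j \<in> {1..n}")
      case True
      then have "r (j - 1) \<le> p" using that by auto
      then have "real (r (j - 1)) / real p \<in> {0..1}" using that by auto
      then show ?thesis
        using lohi[of j] mult_left_le[of "real (r (j - 1)) / real p" "hi j - lo j"]
        by (simp add: grid_def)
    qed (use degenerate in \<open>simp add: grid_def\<close>)
    then show ?thesis by (simp add: le_fun_def)
  qed
  \<comment> \<open>Kuhn's lemma prescribes 0 where \<open>r i = 0\<close> and 1 where
    \<open>r i = p\<close>. The face hypotheses exclude membership in \<open>V\<close> in the first
    case and in \<open>U\<close> in the second.\<close>
  define label where "label p r i = (if F (grid p r) \<in> U (Suc i) then 0
      else if F (grid p r) \<in> V (Suc i) \<or> r i = p then 1 else 0 :: nat)" for p r i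
  define cell where "cell p q \<longleftrightarrow> (\<forall>i<n. q i < p) \<and> (\<forall>i<n. \<exists>r s. (\<forall>j<n. q j \<le> r j \<and> r j \<le> q j + 1) \<and>
      (\<forall>j<n. q j \<le> s j \<and> s j \<le> q j + 1) \<and> label p r i \<noteq> label p s i)" for p and q :: "nat \<Rightarrow> nat"
  have "\<exists>q. cell p q" if "0 < p" for p
  proof (rule kuhn_lemma[of p n "label p"])
    show "0 < p" by fact
    show "\<forall>x. (\<forall>i<n. x i \<le> p) \<longrightarrow> (\<forall>i<n. label p x i = 0 \<or> label p x i = 1)"
      by (simp add: label_def)
    show "\<forall>x. (\<forall>i<n. x i \<le> p) \<longrightarrow> (\<forall>i<n. x i = 0 \<longrightarrow> label p x i = 0)"
      using lo_face[OF _ grid_in] that by (auto simp: label_def grid_def)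
    show "\<forall>x. (\<forall>i<n. x i \<le> p) \<longrightarrow> (\<forall>i<n. x i = p \<longrightarrow> label p x i = 1)"
      using hi_face[OF _ grid_in] that by (auto simp: label_def grid_def)
  qed (unfold cell_def, blast)
  then have "\<forall>m. \<exists>q. cell (Suc m) q" by blast
  then obtain q where cell: "\<And>m. cell (Suc m) (q m)" by metis
  have q: "q m i < Suc m" if "i < n" for m i using cell that unfolding cell_def by blast
  have q_le: "\<forall>i<n. q m i \<le> Suc m" for m using q less_imp_le by blast
  have z_in: "\<forall>m. grid (Suc m) (q m) \<in> {lo..hi}" using grid_in[OF _ q_le] by blast
  obtain z \<phi> where z: "z \<in> {lo..hi}" and \<phi>: "strict_mono \<phi>"
    and lim: "((\<lambda>m. grid (Suc m) (q m)) \<circ> \<phi>) \<longlonglongrightarrow> z"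
    using compact_imp_seq_compact[OF compact_function_interval] z_in by (rule seq_compactE)
  have eventually_in: "\<forall>\<^sub>F m in sequentially. F (grid (Suc (\<phi> m)) (r m)) \<in> W"
    if W: "open W" "F z \<in> W" and r: "\<And>m j. j < n \<Longrightarrow> q (\<phi> m) j \<le> r m j \<and> r m j \<le> q (\<phi> m) j + 1"
    for W r
  proof -
    \<comment> \<open>Vertices of one cell differ by at most one grid step, and
      \<open>m \<le> \<phi> m\<close>. So any choice of vertices in the selected cells converges to
      the same \<open>z\<close>.\<close>
    have small: "\<bar>grid (Suc (\<phi> m)) (r m) j - grid (Suc (\<phi> m)) (q (\<phi> m)) j\<bar>
        \<le> (hi j - lo j) * inverse (real (Suc m))" for m j
    proof (cases "j \<in> {1..n}")
      case True
      then have "j - 1 < n" by auto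
      then have "\<bar>real (r m (j - 1)) - real (q (\<phi> m) (j - 1))\<bar> \<le> 1"
        using r[of "j - 1" m] by linarith
      moreover have "m \<le> \<phi> m" using \<phi> by (rule seq_suble)
      ultimately have "\<bar>real (r m (j - 1)) - real (q (\<phi> m) (j - 1))\<bar> / real (Suc (\<phi> m))
          \<le> 1 / real (Suc m)"
        by (intro frac_le) auto
      then have "(hi j - lo j) * (\<bar>real (r m (j - 1)) - real (q (\<phi> m) (j - 1))\<bar> / real (Suc (\<phi> m)))
          \<le> (hi j - lo j) * (1 / real (Suc m))"
        using lohi[of j] by (intro mult_left_mono) auto
      moreover have "grid (Suc (\<phi> m)) (r m) j - grid (Suc (\<phi> m)) (q (\<phi> m)) j =
          (hi j - lo j) * ((real (r m (j - 1)) - real (q (\<phi> m) (j - 1))) / real (Suc (\<phi> m)))"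
        by (simp add: grid_def right_diff_distrib diff_divide_distrib)
      ultimately show ?thesis using lohi[of j] by (simp add: abs_mult inverse_eq_divide)
    qed (use degenerate in \<open>simp add: grid_def\<close>)
    have "(\<lambda>m. grid (Suc (\<phi> m)) (r m) j) \<longlonglongrightarrow> z j" for j
    proof -
      have "(\<lambda>m. (hi j - lo j) * inverse (real (Suc m))) \<longlonglongrightarrow> 0"
        using tendsto_mult_right_zero[OF LIMSEQ_inverse_real_of_nat] .
      then have "(\<lambda>m. grid (Suc (\<phi> m)) (r m) j - grid (Suc (\<phi> m)) (q (\<phi> m)) j) \<longlonglongrightarrow> 0"
        by (rule Lim_null_comparison[rotated]) (use small in auto)
      moreover have "continuous_on UNIV (\<lambda>y :: nat \<Rightarrow> real. y j)" by simp
      then have "isCont (\<lambda>y :: nat \<Rightarrow> real. y j) z"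
        using continuous_on_eq_continuous_at open_UNIV by blast
      then have "(\<lambda>m. ((\<lambda>m. grid (Suc m) (q m)) \<circ> \<phi>) m j) \<longlonglongrightarrow> z j"
        by (rule isCont_tendsto_compose[OF _ lim])
      ultimately show ?thesis using tendsto_add[of _ 0 _ _ "z j"] by fastforce
    qed
    then have "(\<lambda>m. grid (Suc (\<phi> m)) (r m)) \<longlonglongrightarrow> z" by (rule tendsto_funI)
    moreover have "grid (Suc (\<phi> m)) (r m) \<in> {lo..hi}" for m
      using r q by (intro grid_in) (auto, meson Suc_leI le_trans)
    ultimately have "(\<lambda>m. F (grid (Suc (\<phi> m)) (r m))) \<longlonglongrightarrow> F z"
      using continuous_on_tendsto_compose[OF cont _ z] always_eventually by blast
    then show ?thesis using W by (rule topological_tendstoD)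
  qed
  obtain k where k: "k \<in> {1..n}" "F z \<in> U k \<union> V k" using cover[OF z] by blast
  then have "k - 1 < n" by auto
  then have "\<forall>m. \<exists>r s. (\<forall>j<n. q (\<phi> m) j \<le> r j \<and> r j \<le> q (\<phi> m) j + 1) \<and>
      (\<forall>j<n. q (\<phi> m) j \<le> s j \<and> s j \<le> q (\<phi> m) j + 1) \<and>
      label (Suc (\<phi> m)) r (k - 1) \<noteq> label (Suc (\<phi> m)) s (k - 1)"
    using cell \<open>k - 1 < n\<close> unfolding cell_def by blast
  then have "\<forall>m. \<exists>u. (\<forall>j<n. q (\<phi> m) j \<le> fst u j \<and> fst u j \<le> q (\<phi> m) j + 1) \<and>
      (\<forall>j<n. q (\<phi> m) j \<le> snd u j \<and> snd u j \<le> q (\<phi> m) j + 1) \<and>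
      label (Suc (\<phi> m)) (fst u) (k - 1) \<noteq> label (Suc (\<phi> m)) (snd u) (k - 1)"
    by simp
  from choice[OF this] obtain u where u: "\<forall>m. (\<forall>j<n. q (\<phi> m) j \<le> fst (u m) j \<and> fst (u m) j \<le> q (\<phi> m) j + 1) \<and>
      (\<forall>j<n. q (\<phi> m) j \<le> snd (u m) j \<and> snd (u m) j \<le> q (\<phi> m) j + 1) \<and>
      label (Suc (\<phi> m)) (fst (u m)) (k - 1) \<noteq> label (Suc (\<phi> m)) (snd (u m)) (k - 1)" ..
  define r s where "r = (\<lambda>m. fst (u m))" and "s = (\<lambda>m. snd (u m))"
  have r: "\<And>m j. j < n \<Longrightarrow> q (\<phi> m) j \<le> r m j \<and> r m j \<le> q (\<phi> m) j + 1"
    and s: "\<And>m j. j < n \<Longrightarrow> q (\<phi> m) j \<le> s m j \<and> s m j \<le> q (\<phi> m) j + 1"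
    and neq: "\<And>m. label (Suc (\<phi> m)) (r m) (k - 1) \<noteq> label (Suc (\<phi> m)) (s m) (k - 1)"
    using u by (simp_all add: r_def s_def)
  have Suc_k: "Suc (k - 1) = k" using k(1) by auto
  \<comment> \<open>Eventually both vertices \<open>r m\<close> and \<open>s m\<close> are mapped
    into \<open>W\<close>. If \<open>W\<close> is \<open>U k\<close>, both labels are 0; if it is
    \<open>V k\<close>, disjointness keeps the points out of \<open>U k\<close> and both labels are
    1.\<close>
  obtain W where W: "W = U k \<or> W = V k" "F z \<in> W" using k by blast
  have "open W" using W open_U open_V k by blast
  then have "\<forall>\<^sub>F m in sequentially. F (grid (Suc (\<phi> m)) (r m)) \<in> W \<and> F (grid (Suc (\<phi> m)) (s m)) \<in> W"
    using eventually_in[OF _ W(2) r] eventually_in[OF _ W(2) s] by (simp add: eventually_conj)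
  then obtain m where "F (grid (Suc (\<phi> m)) (r m)) \<in> W" "F (grid (Suc (\<phi> m)) (s m)) \<in> W"
    using eventually_happens'[OF sequentially_bot] by blast
  then show False
    using neq[of m, unfolded label_def Suc_k] W(1) disj[OF k(1)] by (auto split: if_splits)
qed

section \<open>Rational balls in a computable metric space\<close>

text \<open>The bound is a Lebesgue number of the cover of \<open>C\<close> by the single open set
  \<open>- P\<close>. This form covers empty sets as well.\<close>

lemma compact_sets_apart:
  fixes C P :: "'a::metric_space set"
  assumes "compact C" "compact P" "C \<inter> P = {}"
  shows "\<exists>d>0. \<forall>x\<in>C. \<forall>y\<in>P. d \<le> dist x y"
proof -
  have "C \<subseteq> \<Union>{- P}" and "open (- P)" using assms(2,3) compact_imp_closed by auto
  then obtain d where "0 < d" and d: "\<And>x. x \<in> C \<Longrightarrow> ball x d \<subseteq> - P"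
    using Heine_Borel_lemma[OF assms(1), of "{- P}"] by auto
  then have "d \<le> dist x y" if "x \<in> C" "y \<in> P" for x y
    using that d[of x] by (meson ComplD mem_ball not_le subsetD)
  then show ?thesis using \<open>0 < d\<close> by blast
qed

locale rational_balls =
  fixes \<alpha> :: "nat \<Rightarrow> 'a::metric_space"
    and q :: "nat \<Rightarrow> real" and \<tau>1 \<tau>2 :: "nat \<Rightarrow> nat"
    and \<sigma> :: "nat \<Rightarrow> nat \<Rightarrow> nat" and \<eta> :: "nat \<Rightarrow> nat"
  assumes space: "computable_metric_space \<alpha>"
    and enum: "good_enum q \<tau>1 \<tau>2 \<sigma> \<eta>"
begin

abbreviation rad :: "nat \<Rightarrow> real" where
  "rad e \<equiv> q (\<tau>2 e)"

abbreviation B :: "nat \<Rightarrow> 'a set" where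
  "B e \<equiv> ball (\<alpha> (\<tau>1 e)) (rad e)"

abbreviation J :: "nat \<Rightarrow> 'a set" where
  "J \<equiv> union_J \<alpha> q \<tau>1 \<tau>2 \<sigma> \<eta>"

abbreviation semicomputable :: "'a set \<Rightarrow> bool" where
  "semicomputable \<equiv> semi_computable_compact \<alpha> q \<tau>1 \<tau>2 \<sigma> \<eta>"

text \<open>Formal disjointness of two balls. As a strict inequality between computable numbers it
  can be confirmed by approximation, whereas disjointness of the balls as sets need not be
  semidecidable.\<close>

definition far_apart :: "nat \<Rightarrow> nat \<Rightarrow> bool" where
  "far_apart e e' \<longleftrightarrow> rad e + rad e' < dist (\<alpha> (\<tau>1 e)) (\<alpha> (\<tau>1 e'))"

lemma J_eq: "J j = (\<Union>e\<in>idx \<sigma> \<eta> j. B e)"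
  by (simp add: union_J_def ball_I_def)

lemma far_apart_disjoint: "far_apart e e' \<Longrightarrow> y \<in> B e \<Longrightarrow> y \<notin> B e'"
proof
  assume "far_apart e e'" "y \<in> B e" "y \<in> B e'"
  moreover have "dist (\<alpha> (\<tau>1 e)) (\<alpha> (\<tau>1 e')) \<le> dist (\<alpha> (\<tau>1 e)) y + dist (\<alpha> (\<tau>1 e')) y"
    by (rule dist_triangle2)
  ultimately show False by (simp add: far_apart_def)
qed

text \<open>Each centre is within \<open>\<epsilon>\<close> of its point, so the centres are more
  than \<open>2 * \<epsilon>\<close> apart, which exceeds the sum of the radii. This is where the
  factor 4 comes from.\<close>

lemma far_apart_if_dist:
  assumes "y \<in> B e" "rad e < \<epsilon>" "y' \<in> B e'" "rad e' < \<epsilon>" "4 * \<epsilon> \<le> dist y y'"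
  shows "far_apart e e'"
proof -
  have "dist y y' \<le> dist (\<alpha> (\<tau>1 e)) y + dist (\<alpha> (\<tau>1 e)) (\<alpha> (\<tau>1 e')) + dist (\<alpha> (\<tau>1 e')) y'"
    using dist_triangle3[of y y' "\<alpha> (\<tau>1 e)"] dist_triangle[of "\<alpha> (\<tau>1 e)" y' "\<alpha> (\<tau>1 e')"] by linarith
  then show ?thesis using assms by (simp add: far_apart_def)
qed

lemma ex_small_ball: "0 < r \<Longrightarrow> \<exists>e. y \<in> B e \<and> rad e < r"
proof -
  assume "0 < r"
  then obtain \<rho> where \<rho>: "\<rho> \<in> \<rat>" "0 < \<rho>" "\<rho> < r" using Rats_dense_in_real by blast
  then have "\<rho> \<in> range q" using enum by (simp add: good_enum_def)
  then obtain b where b: "q b = \<rho>" by blast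
  have "y \<in> closure (range \<alpha>)" using space by (simp add: computable_metric_space_def)
  then obtain a where a: "dist (\<alpha> a) y < \<rho>" using \<rho>(2) closure_approachable by blast
  have "(a, b) \<in> range (\<lambda>i. (\<tau>1 i, \<tau>2 i))" using enum by (simp add: good_enum_def)
  then obtain e where "\<tau>1 e = a" "\<tau>2 e = b" by auto
  then show ?thesis using a b \<rho> by (intro exI[of _ e]) auto
qed

lemma ex_idx:
  assumes "finite E" "E \<noteq> {}"
  shows "\<exists>j. idx \<sigma> \<eta> j = E"
proof -
  obtain l where l: "set l = E" using assms(1) finite_list by blast
  then have "l \<in> range (\<lambda>j. map (\<sigma> j) [0..<Suc (\<eta> j)])"
    using assms(2) enum by (auto simp: good_enum_def)
  then obtain j where "l = map (\<sigma> j) [0..<Suc (\<eta> j)]" by blast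
  then have "idx \<sigma> \<eta> j = set l"
    by (simp add: idx_def atLeastLessThanSuc_atLeastAtMost del: upt_Suc)
  then show ?thesis using l by blast
qed

lemma compact_ball_cover:
  assumes "compact K" and "\<And>y. y \<in> K \<Longrightarrow> \<exists>e. P e \<and> y \<in> B e"
  shows "\<exists>E. finite E \<and> (\<forall>e\<in>E. P e) \<and> K \<subseteq> (\<Union>e\<in>E. B e)"
proof -
  have "K \<subseteq> (\<Union>e\<in>Collect P. B e)" using assms(2) by blast
  with assms(1) obtain E where "E \<subseteq> Collect P" "finite E" "K \<subseteq> (\<Union>e\<in>E. B e)"
    using compactE_image[of K "Collect P" B] by auto
  then show ?thesis by blast
qed

section \<open>Semidecidable relations between balls and index sets\<close>

lemma semidecidable_far_apart:
  assumes "computable1 f" and "computable1 g"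
  shows "semidecidable (\<lambda>a. far_apart (f a) (g a))"
proof -
  obtain G where G: "computable3 G"
    "\<And>a b i. \<bar>dist (\<alpha> a) (\<alpha> b) - rat_code (G a b i)\<bar> < (1/2) ^ i"
    using space unfolding computable_metric_space_def computable_real2_def by blast
  have c: "computable_rat1 q" "computable1 \<tau>1" "computable1 \<tau>2"
    using enum by (auto simp: good_enum_def)
  have eq: "far_apart e e' \<longleftrightarrow>
      (\<exists>i. rad e + rad e' + (1/2) ^ i < rat_code (G (\<tau>1 e) (\<tau>1 e') i))" for e e'
  proof
    assume "far_apart e e'"
    then have "0 < dist (\<alpha> (\<tau>1 e)) (\<alpha> (\<tau>1 e')) - (rad e + rad e')" by (simp add: far_apart_def)
    \<comment> \<open>Half of the gap, because one \<open>(1/2) ^ i\<close> is the margin of the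
      criterion and a second one is the approximation error.\<close>
    then obtain i where "(1/2) ^ i < (dist (\<alpha> (\<tau>1 e)) (\<alpha> (\<tau>1 e')) - (rad e + rad e')) / 2"
      using real_arch_pow_inv[of "(dist (\<alpha> (\<tau>1 e)) (\<alpha> (\<tau>1 e')) - (rad e + rad e')) / 2" "1/2"] by auto
    then show "\<exists>i. rad e + rad e' + (1/2) ^ i < rat_code (G (\<tau>1 e) (\<tau>1 e') i)"
      using G(2)[of "\<tau>1 e" "\<tau>1 e'" i] by (intro exI[of _ i]) (simp add: abs_less_iff field_simps)
  next
    assume "\<exists>i. rad e + rad e' + (1/2) ^ i < rat_code (G (\<tau>1 e) (\<tau>1 e') i)"
    then obtain i where "rad e + rad e' + (1/2) ^ i < rat_code (G (\<tau>1 e) (\<tau>1 e') i)" by blast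
    then show "far_apart e e'"
      using G(2)[of "\<tau>1 e" "\<tau>1 e'" i] by (simp add: far_apart_def abs_less_iff)
  qed
  show ?thesis unfolding eq
    by (intro semidecidable_ex semidecidable_rat_less computable_rat1_add computable_rat1_code
        computable_rat1_half_power computable_rat1_comp[OF c(1)] computable1_comp[OF c(3)]
        computable1_comp3[OF G(1)] computable1_comp[OF c(2)] computable1_comp[OF assms(1)]
        computable1_comp[OF assms(2)] computable1_basic)
qed

lemma semidecidable_rad_less:
  assumes "computable1 f" and "computable1 g"
  shows "semidecidable (\<lambda>a. rad (f a) < (1/2) ^ g a)"
proof -
  have c: "computable_rat1 q" "computable1 \<tau>2" using enum by (auto simp: good_enum_def)
  show ?thesis
    by (intro semidecidable_rat_less computable_rat1_half_power computable_rat1_comp[OF c(1)]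
        computable1_comp[OF c(2)] assms)
qed

lemmas computable1_\<sigma> =
  computable1_comp2[OF enum[unfolded good_enum_def, THEN conjunct2, THEN conjunct2, THEN conjunct2,
      THEN conjunct2, THEN conjunct2, THEN conjunct1]]

lemmas computable1_\<eta> =
  computable1_comp[OF enum[unfolded good_enum_def, THEN conjunct2, THEN conjunct2, THEN conjunct2,
      THEN conjunct2, THEN conjunct2, THEN conjunct2, THEN conjunct1]]

lemmas computable1_\<tau>1 =
  computable1_comp[OF enum[unfolded good_enum_def, THEN conjunct2, THEN conjunct2, THEN conjunct1]]

lemma semidecidable_idx_all:
  assumes "semidecidable (\<lambda>b. P (pfst b) (psnd b))" and "computable1 h"
  shows "semidecidable (\<lambda>a. \<forall>e\<in>idx \<sigma> \<eta> (h a). P e a)"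
proof -
  have eq: "(\<forall>e\<in>idx \<sigma> \<eta> (h a). P e a) \<longleftrightarrow> (\<forall>i<Suc (\<eta> (h a)). P (\<sigma> (h a) i) a)" for a
    by (auto simp: idx_def less_Suc_eq_le)
  have "semidecidable (\<lambda>b. P (\<sigma> (h (psnd b)) (pfst b)) (psnd b))"
    using semidecidable_comp[OF assms(1), of "\<lambda>b. pr (\<sigma> (h (psnd b)) (pfst b)) (psnd b)"]
      computable1_pr[OF computable1_\<sigma>[OF computable1_comp[OF assms(2)]], of psnd pfst psnd]
    by (simp add: computable1_fst computable1_snd computable1_id)
  then show ?thesis unfolding eq
    by (intro semidecidable_all_less computable1_Suc computable1_\<eta> assms)
qed

lemma semidecidable_idx_ex:
  assumes "semidecidable (\<lambda>b. P (pfst b) (psnd b))" and "computable1 h"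
  shows "semidecidable (\<lambda>a. \<exists>e\<in>idx \<sigma> \<eta> (h a). P e a)"
proof -
  have eq: "(\<exists>e\<in>idx \<sigma> \<eta> (h a). P e a) \<longleftrightarrow> (\<exists>i. i \<le> \<eta> (h a) \<and> P (\<sigma> (h a) i) a)" for a
    by (auto simp: idx_def)
  have "semidecidable (\<lambda>b. P (\<sigma> (h (psnd b)) (pfst b)) (psnd b))"
    using semidecidable_comp[OF assms(1), of "\<lambda>b. pr (\<sigma> (h (psnd b)) (pfst b)) (psnd b)"]
      computable1_pr[OF computable1_\<sigma>[OF computable1_comp[OF assms(2)]], of psnd pfst psnd]
    by (simp add: computable1_fst computable1_snd computable1_id)
  then show ?thesis unfolding eq
    by (intro semidecidable_ex semidecidable_conj semidecidable_le computable1_\<eta> computable1_fst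
        computable1_snd computable1_id computable1_comp[OF assms(2)])
qed

lemma semidecidable_cover:
  assumes "semicomputable K" and "computable1 h"
  shows "semidecidable (\<lambda>a. K \<subseteq> J (h a))"
  using semidecidable_comp[OF semidecidable_c_e assms(2)] assms(1)
  unfolding semi_computable_compact_def by fastforce

lemma semidecidable_mem_finite: "finite E \<Longrightarrow> computable1 h \<Longrightarrow> semidecidable (\<lambda>a. h a \<in> E)"
  using semidecidable_finite_bex[of E "\<lambda>e a. h a = e"] semidecidable_eq[OF _ computable1_const] by auto

section \<open>Balls that provably avoid a compact set\<close>

text \<open>\<open>Av\<close> tests formal disjointness from finitely many balls covering
  \<open>C\<close>, which can be built into the program. Radii below a quarter of the separation of
  \<open>C\<close> and \<open>P\<close> make the test succeed on every ball that meets
  \<open>P\<close>.\<close>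

lemma avoid_compact:
  assumes "compact C" "compact P" "C \<inter> P = {}"
  shows "\<exists>Av. semidecidable Av \<and> (\<forall>e. Av e \<longrightarrow> B e \<inter> C = {}) \<and>
    (\<exists>\<epsilon>>0. \<forall>e. rad e < \<epsilon> \<longrightarrow> B e \<inter> P \<noteq> {} \<longrightarrow> Av e)"
proof -
  obtain d where d: "0 < d" "\<And>x y. x \<in> C \<Longrightarrow> y \<in> P \<Longrightarrow> d \<le> dist x y"
    using compact_sets_apart[OF assms] by blast
  have "\<exists>e. (rad e < d / 4 \<and> B e \<inter> C \<noteq> {}) \<and> y \<in> B e" if "y \<in> C" for y
    using ex_small_ball[of "d / 4" y] d(1) that by fastforce
  from compact_ball_cover[OF assms(1) this] obtain E where E: "finite E"
    "\<And>e. e \<in> E \<Longrightarrow> rad e < d / 4 \<and> B e \<inter> C \<noteq> {}" "C \<subseteq> (\<Union>e\<in>E. B e)" by blast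
  define Av where "Av e \<longleftrightarrow> (\<forall>e'\<in>E. far_apart e e')" for e
  have "semidecidable Av" unfolding Av_def
    by (intro semidecidable_finite_ball E semidecidable_far_apart computable1_basic)
  moreover have "B e \<inter> C = {}" if "Av e" for e
    using that far_apart_disjoint E(3) unfolding Av_def by blast
  moreover have "Av e" if e: "rad e < d / 4" "B e \<inter> P \<noteq> {}" for e
    unfolding Av_def
  proof
    fix e' assume "e' \<in> E"
    obtain y y' where "y \<in> B e" "y \<in> P" "y' \<in> B e'" "y' \<in> C" using e E(2)[OF \<open>e' \<in> E\<close>] by blast
    then show "far_apart e e'"
      using far_apart_if_dist[of y e "d / 4" y' e'] e E(2)[OF \<open>e' \<in> E\<close>] d(2)[of y' y]
      by (simp add: dist_commute)
  qed
  ultimately show ?thesis using d(1) by (intro exI[of _ Av] conjI exI[of _ "d / 4"]) auto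
qed

text \<open>Here one test must serve every compact \<open>P\<close> disjoint from \<open>C\<close>,
  at distances without a common lower bound. The fixed finite cover is therefore replaced by a
  search through all covers of \<open>C\<close>.\<close>

lemma avoid_semicomputable:
  assumes "semicomputable C"
  shows "\<exists>Av. semidecidable Av \<and> (\<forall>e. Av e \<longrightarrow> B e \<inter> C = {}) \<and>
    (\<forall>P. compact P \<longrightarrow> C \<inter> P = {} \<longrightarrow> (\<exists>\<epsilon>>0. \<forall>e. rad e < \<epsilon> \<longrightarrow> B e \<inter> P \<noteq> {} \<longrightarrow> Av e))"
proof (cases "C = {}")
  \<comment> \<open>Index sets are nonempty, so in a bounded space the certificate used below may be unavailable
    when \<open>C\<close> is empty.\<close>
  case True
  then show ?thesis
    by (intro exI[of _ "\<lambda>e. True"]) (auto intro: semidecidable_const exI[of _ 1])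
next
  case False
  have "compact C" using assms by (simp add: semi_computable_compact_def)
  define Av where "Av e \<longleftrightarrow> (\<exists>j. C \<subseteq> J j \<and> (\<forall>e'\<in>idx \<sigma> \<eta> j. far_apart e e'))" for e
  have "semidecidable Av" unfolding Av_def
    by (intro semidecidable_ex semidecidable_conj semidecidable_cover[OF assms] semidecidable_idx_all
        semidecidable_far_apart computable1_basic)
  moreover have "B e \<inter> C = {}" if "Av e" for e
    using that far_apart_disjoint unfolding Av_def J_eq by blast
  moreover have "\<exists>\<epsilon>>0. \<forall>e. rad e < \<epsilon> \<longrightarrow> B e \<inter> P \<noteq> {} \<longrightarrow> Av e" if P: "compact P" "C \<inter> P = {}" for P
  proof -
    obtain d where d: "0 < d" "\<And>x y. x \<in> C \<Longrightarrow> y \<in> P \<Longrightarrow> d \<le> dist x y"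
      using compact_sets_apart[OF \<open>compact C\<close> P] by blast
    have "\<exists>e. (rad e < d / 4 \<and> B e \<inter> C \<noteq> {}) \<and> y \<in> B e" if "y \<in> C" for y
      using ex_small_ball[of "d / 4" y] d(1) that by fastforce
    from compact_ball_cover[OF \<open>compact C\<close> this] obtain E where E: "finite E"
      "\<And>e. e \<in> E \<Longrightarrow> rad e < d / 4 \<and> B e \<inter> C \<noteq> {}" "C \<subseteq> (\<Union>e\<in>E. B e)" by blast
    then have "E \<noteq> {}" using False by auto
    with E(1) obtain j where j: "idx \<sigma> \<eta> j = E" using ex_idx by blast
    have "Av e" if e: "rad e < d / 4" "B e \<inter> P \<noteq> {}" for e
      unfolding Av_def
    proof (intro exI[of _ j] conjI ballI)
      show "C \<subseteq> J j" using E(3) by (simp add: J_eq j)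
      fix e' assume "e' \<in> idx \<sigma> \<eta> j"
      then have "e' \<in> E" by (simp add: j)
      obtain y y' where "y \<in> B e" "y \<in> P" "y' \<in> B e'" "y' \<in> C" using e E(2)[OF \<open>e' \<in> E\<close>] by blast
      then show "far_apart e e'"
        using far_apart_if_dist[of y e "d / 4" y' e'] e E(2)[OF \<open>e' \<in> E\<close>] d(2)[of y' y]
        by (simp add: dist_commute)
    qed
    then show ?thesis using d(1) by (intro exI[of _ "d / 4"]) auto
  qed
  ultimately show ?thesis by blast
qed

end

section \<open>Certified intersection with a cell\<close>

lemma ex_uniform_pos:
  fixes P :: "'k \<Rightarrow> real \<Rightarrow> bool"
  assumes "finite K" and "\<And>k. k \<in> K \<Longrightarrow> \<exists>\<epsilon>>0. P k \<epsilon>"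
    and mono: "\<And>k \<delta> \<epsilon>. P k \<epsilon> \<Longrightarrow> 0 < \<delta> \<Longrightarrow> \<delta> \<le> \<epsilon> \<Longrightarrow> P k \<delta>"
  shows "\<exists>\<epsilon>>0. \<forall>k\<in>K. P k \<epsilon>"
  using assms(1,2)
proof (induction K rule: finite_induct)
  case empty
  show ?case by (intro exI[of _ 1]) auto
next
  case (insert k K)
  then obtain \<epsilon> where \<epsilon>: "0 < \<epsilon>" "\<forall>k\<in>K. P k \<epsilon>" by auto
  obtain \<delta> where \<delta>: "0 < \<delta>" "P k \<delta>" using insert.prems by auto
  have "P l (min \<epsilon> \<delta>)" if "l \<in> insert k K" for l
    using that \<epsilon> \<delta> mono[of l \<epsilon> "min \<epsilon> \<delta>"] mono[of k \<delta> "min \<epsilon> \<delta>"] by auto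
  then show ?case using \<epsilon>(1) \<delta>(1) by (intro exI[of _ "min \<epsilon> \<delta>"]) auto
qed

text \<open>Coordinates outside \<open>K\<close> are constant on \<open>R\<close>, so closeness in
  \<open>K\<close> controls the point. The argument uses sequences because convergence in the
  product topology of \<open>nat \<Rightarrow> real\<close> is coordinatewise.\<close>

lemma continuous_on_cube_neighborhood:
  fixes f :: "(nat \<Rightarrow> real) \<Rightarrow> 'a::topological_space"
  assumes degenerate: "\<And>i y. i \<notin> K \<Longrightarrow> y \<in> R \<Longrightarrow> y i = c i"
    and cont: "continuous_on R f" and p: "p \<in> R" "f p \<in> W" and W: "open W"
  shows "\<exists>\<delta>>0. \<forall>y\<in>R. (\<forall>i\<in>K. \<bar>y i - p i\<bar> < \<delta>) \<longrightarrow> f y \<in> W"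
proof (rule ccontr)
  assume "\<not> ?thesis"
  then have "\<forall>m. \<exists>y\<in>R. (\<forall>i\<in>K. \<bar>y i - p i\<bar> < inverse (real (Suc m))) \<and> f y \<notin> W"
    by (metis inverse_positive_iff_positive of_nat_0_less_iff zero_less_Suc)
  then obtain y where y: "\<And>m. y m \<in> R" "\<And>m i. i \<in> K \<Longrightarrow> \<bar>y m i - p i\<bar> < inverse (real (Suc m))"
    "\<And>m. f (y m) \<notin> W" by metis
  have "(\<lambda>m. y m i) \<longlonglongrightarrow> p i" for i
  proof (cases "i \<in> K")
    case True
    have "(\<lambda>m. y m i - p i) \<longlonglongrightarrow> 0"
      by (rule Lim_null_comparison[OF always_eventually LIMSEQ_inverse_real_of_nat])
        (use y(2)[OF True] less_imp_le in \<open>fastforce simp del: of_nat_Suc\<close>)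
    then show ?thesis by (simp add: LIM_zero_iff)
  next
    case False
    then have "y m i = p i" for m using degenerate y(1) p(1) by metis
    then show ?thesis by simp
  qed
  then have "y \<longlonglongrightarrow> p" by (rule tendsto_funI)
  then have "(\<lambda>m. f (y m)) \<longlonglongrightarrow> f p"
    using continuous_on_tendsto_compose[OF cont _ p(1)] y(1) always_eventually by blast
  then have "\<forall>\<^sub>F m in sequentially. f (y m) \<in> W" using W p(2) topological_tendstoD by blast
  then show False using y(3) by simp
qed

lemma continuous_on_coordinate: "continuous_on A (\<lambda>y :: 'i \<Rightarrow> real. y i)"
  by (rule continuous_on_subset[OF continuous_on_product_coordinates]) auto

lemma compact_image_halfcube:
  fixes f :: "('i \<Rightarrow> real) \<Rightarrow> 'a::topological_space"
  assumes "continuous_on {lo..hi} f"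
  shows "compact (f ` {y \<in> {lo..hi}. y k \<le> t})" and "compact (f ` {y \<in> {lo..hi}. t \<le> y k})"
proof -
  have "closed {y :: 'i \<Rightarrow> real. y k \<le> t}" "closed {y :: 'i \<Rightarrow> real. t \<le> y k}"
    by (intro closed_Collect_le continuous_on_coordinate continuous_on_const)+
  then have "compact ({lo..hi} \<inter> {y. y k \<le> t})" "compact ({lo..hi} \<inter> {y. t \<le> y k})"
    using compact_function_interval compact_Int_closed by blast+
  then have "compact (f ` ({lo..hi} \<inter> {y. y k \<le> t}))" "compact (f ` ({lo..hi} \<inter> {y. t \<le> y k}))"
    using assms by (auto intro: compact_continuous_image continuous_on_subset)
  then show "compact (f ` {y \<in> {lo..hi}. y k \<le> t})" "compact (f ` {y \<in> {lo..hi}. t \<le> y k})"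
    by (simp_all add: Int_def)
qed

context rational_balls
begin

text \<open>If a ball missed the cell \<open>f ` {dlo..dhi}\<close>, then the remaining balls of a certificate would cover
  the cell by \<open>n\<close> pairs of disjoint open sets avoiding opposite faces. Conversely, around a point of the
  ball with parameter \<open>p\<close>, the conditions \<open>y k \<le> p k - \<delta>\<close> and \<open>p k + \<delta> \<le> y k\<close> yield such pairs.\<close>

lemma semidecidable_hit:
  fixes f :: "(nat \<Rightarrow> real) \<Rightarrow> 'a"
  assumes S: "semicomputable S"
    and degenerate: "\<And>i. i \<notin> {1..n} \<Longrightarrow> rlo i = rhi i"
    and D: "dlo \<le> dhi" "{dlo..dhi} \<subseteq> {rlo..rhi}"
    and f: "continuous_on {rlo..rhi} f" "inj_on f {rlo..rhi}" "f ` {rlo..rhi} \<subseteq> S"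
    and Out: "finite Out" "S \<subseteq> f ` {rlo..rhi} \<union> (\<Union>e\<in>Out. B e)"
      "\<And>e. e \<in> Out \<Longrightarrow> B e \<inter> f ` {dlo..dhi} = {}"
    and M: "M \<subseteq> {rlo..rhi}"
    and AvU: "\<And>k. k \<in> {1..n} \<Longrightarrow> semidecidable (AvU k)"
      "\<And>k e. k \<in> {1..n} \<Longrightarrow> AvU k e \<Longrightarrow> B e \<inter> f ` {y \<in> {dlo..dhi}. y k = dhi k} = {}"
      "\<And>k p. k \<in> {1..n} \<Longrightarrow> p \<in> M \<Longrightarrow>
        \<exists>\<epsilon>>0. \<forall>e. rad e < \<epsilon> \<longrightarrow> B e \<inter> f ` {y \<in> {rlo..rhi}. y k \<le> p k} \<noteq> {} \<longrightarrow> AvU k e"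
    and AvV: "\<And>k. k \<in> {1..n} \<Longrightarrow> semidecidable (AvV k)"
      "\<And>k e. k \<in> {1..n} \<Longrightarrow> AvV k e \<Longrightarrow> B e \<inter> f ` {y \<in> {dlo..dhi}. y k = dlo k} = {}"
      "\<And>k p. k \<in> {1..n} \<Longrightarrow> p \<in> M \<Longrightarrow>
        \<exists>\<epsilon>>0. \<forall>e. rad e < \<epsilon> \<longrightarrow> B e \<inter> f ` {y \<in> {rlo..rhi}. p k \<le> y k} \<noteq> {} \<longrightarrow> AvV k e"
  shows "\<exists>Hit. semidecidable Hit \<and> (\<forall>e. Hit e \<longrightarrow> B e \<inter> f ` {dlo..dhi} \<noteq> {}) \<and>
    (\<forall>e. \<forall>p\<in>M. f p \<in> B e \<longrightarrow> Hit e)"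
proof -
  \<comment> \<open>The code \<open>c\<close> sorts the balls of a cover of \<open>S\<close>: label 0 is \<open>e\<close> itself, label 1 the balls missing
    the cell, and labels \<open>2 * k\<close> and \<open>2 * k + 1\<close> the two sides of \<open>e\<close> in direction \<open>k\<close>.\<close>
  define labelled where "labelled e j c i \<longleftrightarrow>
      (nth_code c i = 0 \<and> \<sigma> j i = e) \<or> (nth_code c i = 1 \<and> \<sigma> j i \<in> Out) \<or>
      (\<exists>k\<in>{1..n}. (nth_code c i = 2 * k \<and> AvU k (\<sigma> j i)) \<or>
        (nth_code c i = 2 * k + 1 \<and> AvV k (\<sigma> j i)))" for e j c i
  \<comment> \<open>The separation of the two sides is an implication. Label equality being
    decidable, it can be written as a disjunction of semidecidable conditions.\<close>
  define Hit where "Hit e \<longleftrightarrow> (\<exists>j c. S \<subseteq> J j \<and> (\<forall>i<Suc (\<eta> j). labelled e j c i) \<and>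
      (\<forall>i<Suc (\<eta> j). \<forall>i'<Suc (\<eta> j). \<forall>k\<in>{1..n}.
        nth_code c i \<noteq> 2 * k \<or> nth_code c i' \<noteq> 2 * k + 1 \<or> far_apart (\<sigma> j i) (\<sigma> j i')))" for e
  have "semidecidable Hit" unfolding Hit_def labelled_def
    by (intro semidecidable_ex semidecidable_conj semidecidable_disj semidecidable_all_less
        semidecidable_cover[OF S] semidecidable_eq semidecidable_neq semidecidable_mem_finite[OF Out(1)]
        semidecidable_finite_bex semidecidable_finite_ball semidecidable_comp[OF AvU(1)]
        semidecidable_comp[OF AvV(1)] semidecidable_far_apart finite_atLeastAtMost
        computable1_nth_code computable1_\<sigma> computable1_\<eta> computable1_basic)
  moreover have "B e \<inter> f ` {dlo..dhi} \<noteq> {}" if "Hit e" for e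
  proof
    assume miss: "B e \<inter> f ` {dlo..dhi} = {}"
    obtain j c where cover: "S \<subseteq> J j" and lab: "\<And>i. i < Suc (\<eta> j) \<Longrightarrow> labelled e j c i"
      and far: "\<And>i i' k. i < Suc (\<eta> j) \<Longrightarrow> i' < Suc (\<eta> j) \<Longrightarrow> k \<in> {1..n} \<Longrightarrow> nth_code c i = 2 * k
        \<Longrightarrow> nth_code c i' = 2 * k + 1 \<Longrightarrow> far_apart (\<sigma> j i) (\<sigma> j i')"
      using \<open>Hit e\<close> unfolding Hit_def by blast
    define W where "W m = (\<Union>i\<in>{i. i < Suc (\<eta> j) \<and> nth_code c i = m}. B (\<sigma> j i))" for m
    have openW: "open (W m)" for m unfolding W_def by blast
    have "dlo i = dhi i" if "i \<notin> {1..n}" for i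
    proof -
      have "dlo \<in> {rlo..rhi}" "dhi \<in> {rlo..rhi}" using D by auto
      then show ?thesis using degenerate[OF that] by (auto simp: le_fun_def intro: order_antisym dest!: spec[of _ i])
    qed
    moreover have "W (2 * k) \<inter> W (2 * k + 1) = {}" if "k \<in> {1..n}" for k
      using far[OF _ _ that] far_apart_disjoint unfolding W_def by blast
    moreover have "f y \<notin> W (2 * k)" if k: "k \<in> {1..n}" and y: "y \<in> {dlo..dhi}" "y k = dhi k" for k y
    proof
      assume "f y \<in> W (2 * k)"
      then obtain i where i: "i < Suc (\<eta> j)" "nth_code c i = 2 * k" "f y \<in> B (\<sigma> j i)"
        unfolding W_def by blast
      \<comment> \<open>As \<open>k\<close> is positive, the label \<open>2 * k\<close> differs from
        0 and 1, and parity and injectivity exclude every other clause of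
        \<open>labelled\<close>.\<close>
      then have "AvU k (\<sigma> j i)" using lab[OF i(1)] k unfolding labelled_def by auto presburger+
      then show False using AvU(2)[OF k] i(3) y by blast
    qed
    moreover have "f y \<notin> W (2 * k + 1)" if k: "k \<in> {1..n}" and y: "y \<in> {dlo..dhi}" "y k = dlo k" for k y
    proof
      assume "f y \<in> W (2 * k + 1)"
      then obtain i where i: "i < Suc (\<eta> j)" "nth_code c i = 2 * k + 1" "f y \<in> B (\<sigma> j i)"
        unfolding W_def by blast
      then have "AvV k (\<sigma> j i)" using lab[OF i(1)] k unfolding labelled_def by auto presburger+
      then show False using AvV(2)[OF k] i(3) y by blast
    qed
    ultimately obtain y where y: "y \<in> {dlo..dhi}" "\<forall>k\<in>{1..n}. f y \<notin> W (2 * k) \<union> W (2 * k + 1)"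
      using kuhn_cover[OF D(1), of n f "\<lambda>k. W (2 * k)" "\<lambda>k. W (2 * k + 1)"]
        continuous_on_subset[OF f(1) D(2)] openW by blast
    \<comment> \<open>Some ball of the cover contains \<open>f y\<close>, yet no label fits it:
      labels 0 and 1 belong to balls missing the cell, and the remaining ones would put
      \<open>f y\<close> into one of the sets avoided by \<open>y\<close>.\<close>
    then have "f y \<in> J j" using cover f(3) D(2) by blast
    then obtain i where i: "i < Suc (\<eta> j)" "f y \<in> B (\<sigma> j i)"
      unfolding J_eq idx_def by (auto simp: less_Suc_eq_le)
    have "f y \<in> W (nth_code c i)" using i unfolding W_def by blast
    moreover have "\<sigma> j i \<noteq> e" "\<sigma> j i \<notin> Out" using miss Out(3) y(1) i(2) by blast+
    ultimately show False using lab[OF i(1)] y(2) unfolding labelled_def by fastforce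
  qed
  moreover have "Hit e" if p: "p \<in> M" and e: "f p \<in> B e" for e p
  proof -
    have pR: "p \<in> {rlo..rhi}" using p M by blast
    have deg: "y i = rlo i" if "i \<notin> {1..n}" "y \<in> {rlo..rhi}" for i y
      using degenerate[OF that(1)] that(2) by (auto simp: le_fun_def intro: order_antisym dest!: spec[of _ i])
    obtain \<delta> where \<delta>: "0 < \<delta>" "\<And>y. y \<in> {rlo..rhi} \<Longrightarrow> \<forall>i\<in>{1..n}. \<bar>y i - p i\<bar> < \<delta> \<Longrightarrow> f y \<in> B e"
      using continuous_on_cube_neighborhood[of "{1..n}" "{rlo..rhi}" rlo f p "B e"] deg f(1) pR e
      by (metis open_ball)
    \<comment> \<open>The first member of a pair must avoid the upper face, so it collects the
      points on the lower side of \<open>p\<close>; the second member collects the upper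
      side.\<close>
    define PU where "PU k = f ` {y \<in> {rlo..rhi}. y k \<le> p k - \<delta>}" for k
    define PV where "PV k = f ` {y \<in> {rlo..rhi}. p k + \<delta> \<le> y k}" for k
    \<comment> \<open>All three conditions persist when \<open>\<epsilon>\<close> shrinks, so one
      value serves all directions. The bound \<open>4 * \<epsilon>\<close> is what
      \<open>far_apart_if_dist\<close> asks for.\<close>
    define good where "good k \<epsilon> \<longleftrightarrow> (\<forall>x\<in>PU k. \<forall>y\<in>PV k. 4 * \<epsilon> \<le> dist x y) \<and>
        (\<forall>e. rad e < \<epsilon> \<longrightarrow> B e \<inter> PU k \<noteq> {} \<longrightarrow> AvU k e) \<and>
        (\<forall>e. rad e < \<epsilon> \<longrightarrow> B e \<inter> PV k \<noteq> {} \<longrightarrow> AvV k e)" for k \<epsilon>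
    have "\<exists>\<epsilon>>0. \<forall>k\<in>{1..n}. good k \<epsilon>"
    proof (rule ex_uniform_pos)
      fix k assume k: "k \<in> {1..n}"
      have "u \<noteq> v" if uv: "u \<in> PU k" "v \<in> PV k" for u v
      proof -
        obtain y z where "y \<in> {rlo..rhi}" "z \<in> {rlo..rhi}" "y k < z k" "u = f y" "v = f z"
          using uv \<delta>(1) unfolding PU_def PV_def by fastforce
        then show ?thesis using inj_onD[OF f(2)] by blast
      qed
      then have "PU k \<inter> PV k = {}" by blast
      moreover have "compact (PU k)" "compact (PV k)"
        unfolding PU_def PV_def by (intro compact_image_halfcube f(1))+
      ultimately obtain d where d: "0 < d" "\<forall>x\<in>PU k. \<forall>y\<in>PV k. d \<le> dist x y"
        using compact_sets_apart by blast
      obtain \<epsilon>1 where \<epsilon>1: "0 < \<epsilon>1" "\<And>e. rad e < \<epsilon>1 \<Longrightarrow> B e \<inter> f ` {y \<in> {rlo..rhi}. y k \<le> p k} \<noteq> {} \<Longrightarrow> AvU k e"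
        using AvU(3)[OF k p] by blast
      obtain \<epsilon>2 where \<epsilon>2: "0 < \<epsilon>2" "\<And>e. rad e < \<epsilon>2 \<Longrightarrow> B e \<inter> f ` {y \<in> {rlo..rhi}. p k \<le> y k} \<noteq> {} \<Longrightarrow> AvV k e"
        using AvV(3)[OF k p] by blast
      have sub: "PU k \<subseteq> f ` {y \<in> {rlo..rhi}. y k \<le> p k}" "PV k \<subseteq> f ` {y \<in> {rlo..rhi}. p k \<le> y k}"
        using \<delta>(1) unfolding PU_def PV_def by (auto intro!: imageI)
      have "good k (min (d / 4) (min \<epsilon>1 \<epsilon>2))"
        unfolding good_def using d(2) \<epsilon>1(2) \<epsilon>2(2) sub by fastforce
      then show "\<exists>\<epsilon>>0. good k \<epsilon>" using d(1) \<epsilon>1(1) \<epsilon>2(1) by (intro exI[of _ "min (d / 4) (min \<epsilon>1 \<epsilon>2)"]) auto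
    qed (auto simp: good_def, fastforce)
    then obtain \<epsilon> where \<epsilon>: "0 < \<epsilon>" "\<And>k. k \<in> {1..n} \<Longrightarrow> good k \<epsilon>" by blast
    \<comment> \<open>The semantic counterpart of \<open>labelled\<close>: a small ball is sorted by
      a side set that it meets. \<open>good\<close> then supplies both the avoidance tests and the
      formal separation.\<close>
    define lab where "lab e' m \<longleftrightarrow> (m = 0 \<and> e' = e) \<or> (m = 1 \<and> e' \<in> Out) \<or>
        (\<exists>k\<in>{1..n}. rad e' < \<epsilon> \<and> ((m = 2 * k \<and> B e' \<inter> PU k \<noteq> {}) \<or> (m = 2 * k + 1 \<and> B e' \<inter> PV k \<noteq> {})))"
      for e' m
    have "\<exists>e'. (\<exists>m. lab e' m) \<and> y \<in> B e'" if "y \<in> S" for y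
    proof (cases "y \<in> (\<Union>e\<in>Out. B e)")
      case True
      then show ?thesis unfolding lab_def by blast
    next
      case False
      then obtain z where z: "z \<in> {rlo..rhi}" "y = f z" using Out(2) \<open>y \<in> S\<close> by blast
      show ?thesis
      proof (cases "\<forall>i\<in>{1..n}. \<bar>z i - p i\<bar> < \<delta>")
        case True
        then show ?thesis using \<delta>(2)[OF z(1)] z(2) unfolding lab_def by blast
      next
        case False
        then obtain k where k: "k \<in> {1..n}" "\<delta> \<le> \<bar>z k - p k\<bar>" by (auto simp: not_less)
        then have y: "y \<in> PU k \<or> y \<in> PV k"
          using z unfolding PU_def PV_def by (auto simp: abs_le_iff abs_if split: if_splits)
        obtain e' where e': "y \<in> B e'" "rad e' < \<epsilon>" using ex_small_ball[OF \<epsilon>(1)] by blast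
        have "lab e' (2 * k) \<or> lab e' (2 * k + 1)" using y e' k(1) unfolding lab_def by blast
        then show ?thesis using e'(1) by blast
      qed
    qed
    moreover have "compact S" using S by (simp add: semi_computable_compact_def)
    ultimately obtain E where E: "finite E" "\<forall>e'\<in>E. \<exists>m. lab e' m" "S \<subseteq> (\<Union>e'\<in>E. B e')"
      using compact_ball_cover[of S "\<lambda>e'. \<exists>m. lab e' m"] by blast
    have "f p \<in> S" using f(3) pR by blast
    then have "E \<noteq> {}" using E(3) by blast
    with E(1) obtain j where j: "idx \<sigma> \<eta> j = E" using ex_idx by blast
    obtain m where m: "\<And>e'. e' \<in> E \<Longrightarrow> lab e' (m e')" using E(2) by metis
    obtain c where c: "\<And>i. i \<le> \<eta> j \<Longrightarrow> nth_code c i = m (\<sigma> j i)"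
      using ex_nth_code[of "\<eta> j" "\<lambda>i. m (\<sigma> j i)"] by blast
    have lab_i: "lab (\<sigma> j i) (nth_code c i)" if "i < Suc (\<eta> j)" for i
    proof -
      have "\<sigma> j i \<in> E" using that by (auto simp: j[symmetric] idx_def)
      then show ?thesis using m c that by auto
    qed
    have PU: "rad e' < \<epsilon> \<and> B e' \<inter> PU k \<noteq> {}" if "lab e' (2 * k)" "k \<in> {1..n}" for e' k
      using that unfolding lab_def by auto presburger+
    have PV: "rad e' < \<epsilon> \<and> B e' \<inter> PV k \<noteq> {}" if "lab e' (2 * k + 1)" "k \<in> {1..n}" for e' k
      using that unfolding lab_def by auto presburger+
    have "labelled e j c i" if "i < Suc (\<eta> j)" for i
      using lab_i[OF that] \<epsilon>(2) unfolding labelled_def lab_def good_def by blast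
    moreover have "nth_code c i \<noteq> 2 * k \<or> nth_code c i' \<noteq> 2 * k + 1 \<or> far_apart (\<sigma> j i) (\<sigma> j i')"
      if "i < Suc (\<eta> j)" "i' < Suc (\<eta> j)" "k \<in> {1..n}" for i i' k
    proof (rule ccontr)
      assume neg: "\<not> ?thesis"
      then have "rad (\<sigma> j i) < \<epsilon> \<and> B (\<sigma> j i) \<inter> PU k \<noteq> {}" "rad (\<sigma> j i') < \<epsilon> \<and> B (\<sigma> j i') \<inter> PV k \<noteq> {}"
        using lab_i[OF that(1)] lab_i[OF that(2)] PU PV that(3) by auto
      moreover have "\<forall>x\<in>PU k. \<forall>y\<in>PV k. 4 * \<epsilon> \<le> dist x y" using \<epsilon>(2)[OF that(3)] unfolding good_def by blast
      ultimately have "far_apart (\<sigma> j i) (\<sigma> j i')"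
        using far_apart_if_dist[of _ "\<sigma> j i" \<epsilon> _ "\<sigma> j i'"] by blast
      then show False using neg by blast
    qed
    moreover have "S \<subseteq> J j" using E(3) by (simp add: J_eq j)
    ultimately show "Hit e" unfolding Hit_def by blast
  qed
  ultimately show ?thesis by blast
qed

text \<open>The approximating set consists of centres of small certified balls. A point of
  \<open>N\<close> lies in a covering ball outside \<open>Z\<close>, hence near such a centre, and a
  certificate puts each centre near \<open>S\<close>. Away from \<open>N\<close> the balls in
  \<open>Z\<close> relieve the cover of any need for certificates.\<close>

lemma computable_upto_if_hit:
  assumes S: "semicomputable S" and hit: "semidecidable Hit" "\<And>e. Hit e \<Longrightarrow> B e \<inter> S \<noteq> {}"
    and N: "N \<subseteq> S" "N \<noteq> {}" and Z: "finite Z" "\<And>e. e \<in> Z \<Longrightarrow> B e \<inter> N = {}"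
    and cover: "\<And>y r. y \<in> S \<Longrightarrow> 0 < r \<Longrightarrow> (\<exists>e\<in>Z. y \<in> B e) \<or> (\<exists>e. y \<in> B e \<and> rad e < r \<and> Hit e)"
  shows "computable_upto \<alpha> \<sigma> \<eta> N S"
proof -
  \<comment> \<open>The number \<open>m\<close> codes the index of \<open>\<Lambda>\<close> together with the index of a cover of \<open>S\<close> certifying it.\<close>
  define R where "R k m \<longleftrightarrow> S \<subseteq> J (psnd m) \<and>
      (\<forall>e\<in>idx \<sigma> \<eta> (psnd m). e \<in> Z \<or> (rad e < (1/2) ^ k \<and> (\<exists>a\<in>idx \<sigma> \<eta> (pfst m). \<tau>1 e = a))) \<and>
      (\<forall>a\<in>idx \<sigma> \<eta> (pfst m). \<exists>e. \<tau>1 e = a \<and> rad e < (1/2) ^ k \<and> Hit e)" for k m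
  have "semidecidable (\<lambda>b. R (pfst b) (psnd b))" unfolding R_def
    by (intro semidecidable_conj semidecidable_disj semidecidable_ex semidecidable_cover[OF S]
        semidecidable_idx_all semidecidable_idx_ex semidecidable_mem_finite[OF Z(1)]
        semidecidable_rad_less semidecidable_eq semidecidable_comp[OF hit(1)] computable1_\<tau>1
        computable1_basic)
  moreover have "\<exists>m. R k m" for k
  proof -
    have pos: "0 < (1/2 :: real) ^ k" by simp
    have "\<exists>e. (e \<in> Z \<or> (rad e < (1/2) ^ k \<and> Hit e)) \<and> y \<in> B e" if "y \<in> S" for y
      using cover[OF that pos] by blast
    moreover have "compact S" using S by (simp add: semi_computable_compact_def)
    ultimately obtain E where E: "finite E" "\<forall>e\<in>E. e \<in> Z \<or> (rad e < (1/2) ^ k \<and> Hit e)"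
      "S \<subseteq> (\<Union>e\<in>E. B e)"
      using compact_ball_cover[of S "\<lambda>e. e \<in> Z \<or> (rad e < (1/2) ^ k \<and> Hit e)"] by blast
    \<comment> \<open>A point of \<open>N\<close> forces a ball outside \<open>Z\<close> into the
      cover, so the set of centres is nonempty, as an index set must be.\<close>
    obtain y where y: "y \<in> N" using N(2) by blast
    then have "y \<in> (\<Union>e\<in>E. B e)" using E(3) N(1) by blast
    then obtain e0 where "e0 \<in> E" "e0 \<notin> Z" using Z(2) y by blast
    then have ne: "E \<noteq> {}" "\<tau>1 ` (E - Z) \<noteq> {}" by auto
    obtain j' where j': "idx \<sigma> \<eta> j' = E" using ex_idx[OF E(1) ne(1)] by blast
    obtain j where j: "idx \<sigma> \<eta> j = \<tau>1 ` (E - Z)" using ex_idx[OF _ ne(2)] E(1) by blast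
    have "R k (pr j j')" unfolding R_def using E(2,3) by (auto simp: J_eq j j')
    then show ?thesis by blast
  qed
  ultimately obtain F where F: "computable1 F" "\<And>k. R k (F k)"
    using semidecidable_selection[of R] by blast
  have "prec N ((1/2) ^ k) (Lam \<alpha> \<sigma> \<eta> (pfst (F k)))" for k
    unfolding prec_def
  proof
    fix y assume y: "y \<in> N"
    then have "y \<in> J (psnd (F k))" using F(2)[of k] N(1) unfolding R_def by blast
    then obtain e where e: "e \<in> idx \<sigma> \<eta> (psnd (F k))" "y \<in> B e" unfolding J_eq by blast
    then have "e \<notin> Z" using Z(2) y by blast
    then have "rad e < (1/2) ^ k" "\<tau>1 e \<in> idx \<sigma> \<eta> (pfst (F k))" using F(2)[of k] e(1) unfolding R_def by blast+
    then show "\<exists>b\<in>Lam \<alpha> \<sigma> \<eta> (pfst (F k)). dist y b < (1/2) ^ k"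
      using e(2) unfolding Lam_def by (intro bexI[of _ "\<alpha> (\<tau>1 e)"]) (auto simp: dist_commute)
  qed
  moreover have "prec (Lam \<alpha> \<sigma> \<eta> (pfst (F k))) ((1/2) ^ k) S" for k
    unfolding prec_def Lam_def
  proof (rule ballI, elim imageE, hypsubst)
    fix a assume "a \<in> idx \<sigma> \<eta> (pfst (F k))"
    then obtain e where e: "\<tau>1 e = a" "rad e < (1/2) ^ k" "Hit e" using F(2)[of k] unfolding R_def by blast
    then obtain y where "y \<in> S" "y \<in> B e" using hit(2) by blast
    then show "\<exists>b\<in>S. dist (\<alpha> a) b < (1/2) ^ k" using e by (intro bexI[of _ y]) auto
  qed
  ultimately show ?thesis unfolding computable_upto_def using computable1_fst[OF F(1)] by blast
qed

end

section \<open>Cubes in the half-space\<close>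

text \<open>The sup-norm ball about \<open>c\<close> in the half-space, written as an order interval
  to fit \<open>kuhn_cover\<close> and compactness. Clipping the last coordinate at 0 puts its lower
  face on the boundary hyperplane when \<open>c n \<le> r\<close>.\<close>

definition cube_lo :: "nat \<Rightarrow> (nat \<Rightarrow> real) \<Rightarrow> real \<Rightarrow> nat \<Rightarrow> real" where
  "cube_lo n c r i = (if i \<in> {1..n} then (if i = n then max 0 (c i - r) else c i - r) else 0)"

definition cube_hi :: "nat \<Rightarrow> (nat \<Rightarrow> real) \<Rightarrow> real \<Rightarrow> nat \<Rightarrow> real" where
  "cube_hi n c r i = (if i \<in> {1..n} then c i + r else 0)"

abbreviation cube :: "nat \<Rightarrow> (nat \<Rightarrow> real) \<Rightarrow> real \<Rightarrow> (nat \<Rightarrow> real) set" where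
  "cube n c r \<equiv> {cube_lo n c r..cube_hi n c r}"

definition open_cube :: "nat \<Rightarrow> (nat \<Rightarrow> real) \<Rightarrow> real \<Rightarrow> (nat \<Rightarrow> real) set" where
  "open_cube n c r = {y \<in> halfspace n. \<forall>i\<in>{1..n}. \<bar>y i - c i\<bar> < r}"

lemma cube_eq:
  assumes "1 \<le> n"
  shows "cube n c r = {y \<in> halfspace n. \<forall>i\<in>{1..n}. \<bar>y i - c i\<bar> \<le> r}"
proof (intro subset_antisym subsetI)
  fix y assume y: "y \<in> cube n c r"
  then have lh: "cube_lo n c r i \<le> y i" "y i \<le> cube_hi n c r i" for i by (auto simp: le_fun_def)
  have "y i = 0" if "i = 0 \<or> n < i" for i
    using lh[of i] that by (auto simp: cube_lo_def cube_hi_def)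
  moreover have "0 \<le> y n" using lh(1)[of n] assms by (simp add: cube_lo_def)
  moreover have "\<bar>y i - c i\<bar> \<le> r" if "i \<in> {1..n}" for i
    using lh[of i] that by (auto simp: cube_lo_def cube_hi_def abs_le_iff split: if_splits)
  ultimately show "y \<in> {y \<in> halfspace n. \<forall>i\<in>{1..n}. \<bar>y i - c i\<bar> \<le> r}"
    by (simp add: halfspace_def Rn_def)
next
  fix y assume y: "y \<in> {y \<in> halfspace n. \<forall>i\<in>{1..n}. \<bar>y i - c i\<bar> \<le> r}"
  then have h: "0 \<le> y n" "\<And>i. i = 0 \<or> n < i \<Longrightarrow> y i = 0"
    and b: "\<And>i. i \<in> {1..n} \<Longrightarrow> c i - r \<le> y i \<and> y i \<le> c i + r"
    by (auto simp: halfspace_def Rn_def abs_le_iff) (smt (verit) atLeastAtMost_iff)+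
  have "cube_lo n c r i \<le> y i \<and> y i \<le> cube_hi n c r i" for i
  proof (cases "i \<in> {1..n}")
    case True
    then show ?thesis using b[OF True] h(1) by (auto simp: cube_lo_def cube_hi_def)
  next
    case False
    then have "i = 0 \<or> n < i" by auto
    then show ?thesis using h(2)[of i] by (auto simp: cube_lo_def cube_hi_def)
  qed
  then show "y \<in> cube n c r" by (simp add: le_fun_def)
qed

lemma continuous_on_halfspace_neighborhood:
  assumes "continuous_on (halfspace n) f" "p \<in> halfspace n" "f p \<in> W" "open W"
  shows "\<exists>\<delta>>0. \<forall>y\<in>halfspace n. (\<forall>i\<in>{1..n}. \<bar>y i - p i\<bar> < \<delta>) \<longrightarrow> f y \<in> W"
  by (rule continuous_on_cube_neighborhood[where c = "\<lambda>i. 0"])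
    (use assms in \<open>auto simp: halfspace_def Rn_def Suc_le_eq\<close>)

lemma openin_open_cube: "openin (top_of_set (halfspace n)) (open_cube n c r)"
proof -
  have "open {y :: nat \<Rightarrow> real. \<bar>y i - c i\<bar> < r}" for i
    by (intro open_Collect_less continuous_on_rabs continuous_on_diff continuous_on_const
        continuous_on_coordinate)
  then have "open (\<Inter>i\<in>{1..n}. {y :: nat \<Rightarrow> real. \<bar>y i - c i\<bar> < r})" by (intro open_INT) auto
  moreover have "open_cube n c r = halfspace n \<inter> (\<Inter>i\<in>{1..n}. {y. \<bar>y i - c i\<bar> < r})"
    by (auto simp: open_cube_def)
  ultimately show ?thesis by (auto intro: openin_open_Int)
qed

lemma (in rational_balls) finite_cover_avoiding:
  assumes "compact K" "compact C" "K \<inter> C = {}"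
  shows "\<exists>E. finite E \<and> K \<subseteq> (\<Union>e\<in>E. B e) \<and> (\<forall>e\<in>E. B e \<inter> C = {})"
proof -
  obtain d where d: "0 < d" "\<And>x y. x \<in> K \<Longrightarrow> y \<in> C \<Longrightarrow> d \<le> dist x y"
    using compact_sets_apart[OF assms] by blast
  have "\<exists>e. B e \<inter> C = {} \<and> y \<in> B e" if y: "y \<in> K" for y
  proof -
    \<comment> \<open>A ball of radius below \<open>d / 2\<close> has diameter less than
      \<open>d\<close>, so it cannot meet both sets.\<close>
    obtain e where e: "y \<in> B e" "rad e < d / 2" using ex_small_ball[of "d / 2" y] d(1) by auto
    have "z \<notin> C" if "z \<in> B e" for z
    proof
      assume "z \<in> C"
      then have "d \<le> dist y z" using d(2) y by blast
      moreover have "dist y z \<le> dist (\<alpha> (\<tau>1 e)) y + dist (\<alpha> (\<tau>1 e)) z" by (rule dist_triangle3)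
      ultimately show False using e that by simp
    qed
    then show ?thesis using e(1) by blast
  qed
  from compact_ball_cover[OF assms(1) this] show ?thesis by blast
qed

section \<open>Cubes and certificates around the given point\<close>

theorem theorem5p7:
  fixes \<alpha> :: "nat \<Rightarrow> 'a::metric_space"
    and q :: "nat \<Rightarrow> real" and \<tau>1 \<tau>2 :: "nat \<Rightarrow> nat"
    and \<sigma> :: "nat \<Rightarrow> nat \<Rightarrow> nat" and \<eta> :: "nat \<Rightarrow> nat"
    and S T U :: "'a set" and x :: 'a and n :: nat and f :: "(nat \<Rightarrow> real) \<Rightarrow> 'a"
  assumes "computable_metric_space \<alpha>"
    and "good_enum q \<tau>1 \<tau>2 \<sigma> \<eta>"
    and "semi_computable_compact \<alpha> q \<tau>1 \<tau>2 \<sigma> \<eta> S"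
    and "semi_computable_compact \<alpha> q \<tau>1 \<tau>2 \<sigma> \<eta> T"
    and "T \<subseteq> S"
    and "x \<in> S"
    and "neighborhood_in S x U"
    and "1 \<le> n"
    and "\<exists>g. homeomorphism (halfspace n) U f g"
    and "f ` halfspace_bd n = U \<inter> T"
  shows "\<exists>N. neighborhood_in S x N \<and> computable_upto \<alpha> \<sigma> \<eta> N S"
proof -
  interpret rational_balls \<alpha> q \<tau>1 \<tau>2 \<sigma> \<eta> by unfold_locales fact+
  let ?H = "halfspace n"
  note S = assms(3) and T = assms(4)
  have compS: "compact S" using S by (simp add: semi_computable_compact_def)
  obtain g where hom: "homeomorphism ?H U f g" using assms(9) by blast
  have contf: "continuous_on ?H f" and fH: "f ` ?H = U"
    using hom by (auto simp: homeomorphism_def)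
  have injf: "inj_on f ?H" 
    by (rule inj_on_inverseI) (rule homeomorphism_apply1[OF hom])
  obtain V0 where "openin (top_of_set S) V0" and V0: "x \<in> V0" "V0 \<subseteq> U"
    using assms(7) unfolding neighborhood_in_def by blast
  then obtain W where W: "open W" "V0 = S \<inter> W" by (auto simp: openin_open)
  have US: "U \<subseteq> S" using assms(7) unfolding neighborhood_in_def by blast
  define c where "c = g x"
  have c: "c \<in> ?H" "f c = x" using hom V0 unfolding c_def homeomorphism_def by auto
  obtain \<delta> where \<delta>: "0 < \<delta>" "\<And>y. y \<in> ?H \<Longrightarrow> \<forall>i\<in>{1..n}. \<bar>y i - c i\<bar> < \<delta> \<Longrightarrow> f y \<in> W"
    using continuous_on_halfspace_neighborhood[OF contf c(1) _ W(1)] c(2) V0(1) W(2)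
    by blast
  \<comment> \<open>Small enough that the cubes below either stay off the boundary hyperplane or are centred on it.\<close>
  define s where "s = (if c n = 0 then \<delta> else min \<delta> (c n)) / 5"
  have cn: "0 \<le> c n" using c(1) by (simp add: halfspace_def)
  have s: "0 < s" "4 * s < \<delta>" "c n \<noteq> 0 \<Longrightarrow> 4 * s < c n"
    using \<delta>(1) cn by (auto simp: s_def min_def)
  have mem: "y \<in> cube n c r \<longleftrightarrow> y \<in> ?H \<and> (\<forall>i\<in>{1..n}. \<bar>y i - c i\<bar> \<le> r)" for y r
    by (simp add: cube_eq[OF assms(8)])
  have cubeH: "cube n c r \<subseteq> ?H" for r using mem by blast
  have cube_mono: "cube n c r \<subseteq> cube n c r'" if "r \<le> r'" for r r' using mem that by fastforce
  have open_sub: "open_cube n c r \<subseteq> cube n c r" for r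
    using mem unfolding open_cube_def by (blast intro: less_imp_le)
  have cont: "continuous_on (cube n c r) f" for r
    using continuous_on_subset[OF contf cubeH] .
  have inj: "inj_on f (cube n c r)" for r using inj_on_subset[OF injf cubeH] .
  have fcubeS: "f ` cube n c r \<subseteq> S" for r using cubeH fH US by blast
  \<comment> \<open>\<open>U\<close> need not be open in \<open>S\<close>, but
    \<open>S \<inter> W\<close> is contained in \<open>U\<close>. Since these cubes are mapped into
    \<open>W\<close>, openness of their images in \<open>U\<close> gives openness in
    \<open>S\<close>.\<close>
  have open_cube_open: "\<exists>W'. open W' \<and> f ` open_cube n c r = S \<inter> W'" if r: "r \<le> 4 * s" for r
  proof -
    have "openin (top_of_set U) (f ` open_cube n c r)"
      using homeomorphism_imp_open_map[OF hom openin_open_cube] .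
    then obtain W' where W': "open W'" "f ` open_cube n c r = U \<inter> W'" by (auto simp: openin_open)
    have "f ` open_cube n c r \<subseteq> W"
      using \<delta>(2) r s(2) by (fastforce simp: open_cube_def)
    then have "f ` open_cube n c r = S \<inter> (W \<inter> W')" using W'(2) W(2) V0(2) US by blast
    then show ?thesis using W(1) W'(1) by blast
  qed
  have ext: "\<exists>E. finite E \<and> S - f ` open_cube n c r \<subseteq> (\<Union>e\<in>E. B e) \<and> (\<forall>e\<in>E. B e \<inter> f ` cube n c r' = {})"
    if r: "r' < r" "r \<le> 4 * s" for r r'
  proof (rule finite_cover_avoiding)
    obtain W' where "open W'" "f ` open_cube n c r = S \<inter> W'" using open_cube_open[OF r(2)] by blast
    then have "S - f ` open_cube n c r = S - W'" by blast
    then show "compact (S - f ` open_cube n c r)" using compact_diff[OF compS \<open>open W'\<close>] by simp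
    show "compact (f ` cube n c r')"
      using compact_continuous_image[OF cont compact_function_interval] .
    have "cube n c r' \<subseteq> open_cube n c r" using mem r(1) by (fastforce simp: open_cube_def)
    then show "(S - f ` open_cube n c r) \<inter> f ` cube n c r' = {}" by blast
  qed
  \<comment> \<open>\<open>Out\<close> takes care of the part of \<open>S\<close> without parameters
    in the large cube; the gap down to \<open>3 * s\<close> keeps its balls off the cell used for
    certificates.\<close>
  obtain Out where Out: "finite Out" "S - f ` open_cube n c (4 * s) \<subseteq> (\<Union>e\<in>Out. B e)"
    "\<forall>e\<in>Out. B e \<inter> f ` cube n c (3 * s) = {}"
    using ext[of "3 * s" "4 * s"] s(1) by auto
  \<comment> \<open>Outside radius \<open>2 * s\<close> no certificates are sought; the balls of
    \<open>Z\<close> cover that part and miss the neighborhood being approximated.\<close>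
  obtain Z where Z: "finite Z" "S - f ` open_cube n c (2 * s) \<subseteq> (\<Union>e\<in>Z. B e)"
    "\<forall>e\<in>Z. B e \<inter> f ` cube n c s = {}"
    using ext[of s "2 * s"] s(1) by auto
  \<comment> \<open>With \<open>p n\<close> positive, the points whose last coordinate is at least
    \<open>p n\<close> have images off \<open>T\<close>, so small balls meeting these images can be
    separated from \<open>T\<close>.\<close>
  define M where "M = {p \<in> cube n c (2 * s). 0 < p n}"
  have Mb: "c k - 2 * s \<le> p k \<and> p k \<le> c k + 2 * s" if "p \<in> M" "k \<in> {1..n}" for p k
    using that mem[of p "2 * s"] unfolding M_def by (auto simp: abs_le_iff) (smt (verit) atLeastAtMost_iff)+
  define QU where "QU k Av \<longleftrightarrow> semidecidable Av \<and>
      (\<forall>e. Av e \<longrightarrow> B e \<inter> f ` {y \<in> cube n c (3 * s). y k = cube_hi n c (3 * s) k} = {}) \<and>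
      (\<forall>p\<in>M. \<exists>\<epsilon>>0. \<forall>e. rad e < \<epsilon> \<longrightarrow> B e \<inter> f ` {y \<in> cube n c (4 * s). y k \<le> p k} \<noteq> {} \<longrightarrow> Av e)" for k Av
  define QV where "QV k Av \<longleftrightarrow> semidecidable Av \<and>
      (\<forall>e. Av e \<longrightarrow> B e \<inter> f ` {y \<in> cube n c (3 * s). y k = cube_lo n c (3 * s) k} = {}) \<and>
      (\<forall>p\<in>M. \<exists>\<epsilon>>0. \<forall>e. rad e < \<epsilon> \<longrightarrow> B e \<inter> f ` {y \<in> cube n c (4 * s). p k \<le> y k} \<noteq> {} \<longrightarrow> Av e)" for k Av
  have "\<exists>Av. QU k Av" if k: "k \<in> {1..n}" for k
  proof -
    \<comment> \<open>The gap between \<open>2 * s\<close> and \<open>3 * s\<close> gives one pair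
      of disjoint compact sets for all points of \<open>M\<close>, hence a single test.\<close>
    let ?C = "f ` {y \<in> cube n c (3 * s). c k + 3 * s \<le> y k}"
    let ?P = "f ` {y \<in> cube n c (4 * s). y k \<le> c k + 2 * s}"
    have "?C \<inter> ?P = {}"
      using s(1) inj_onD[OF injf] cubeH by fastforce
    then obtain Av \<epsilon> where Av: "semidecidable Av" "\<forall>e. Av e \<longrightarrow> B e \<inter> ?C = {}"
      and \<epsilon>: "0 < \<epsilon>" "\<forall>e. rad e < \<epsilon> \<longrightarrow> B e \<inter> ?P \<noteq> {} \<longrightarrow> Av e"
      using avoid_compact[of ?C ?P] compact_image_halfcube[OF cont] by blast
    have "{y \<in> cube n c (3 * s). y k = cube_hi n c (3 * s) k} \<subseteq> {y \<in> cube n c (3 * s). c k + 3 * s \<le> y k}"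
      using k by (auto simp: cube_hi_def)
    then have 1: "\<forall>e. Av e \<longrightarrow> B e \<inter> f ` {y \<in> cube n c (3 * s). y k = cube_hi n c (3 * s) k} = {}"
      using Av(2) by blast
    have 2: "{y \<in> cube n c (4 * s). y k \<le> p k} \<subseteq> {y \<in> cube n c (4 * s). y k \<le> c k + 2 * s}" if "p \<in> M" for p
      using Mb[OF that k] by auto
    have "\<exists>\<epsilon>>0. \<forall>e. rad e < \<epsilon> \<longrightarrow> B e \<inter> f ` {y \<in> cube n c (4 * s). y k \<le> p k} \<noteq> {} \<longrightarrow> Av e" if "p \<in> M" for p
      using \<epsilon> image_mono[OF 2[OF that], of f] by blast
    then show ?thesis using Av(1) 1 unfolding QU_def by blast
  qed
  then obtain AvU where AvU: "\<And>k. k \<in> {1..n} \<Longrightarrow> QU k (AvU k)" by metis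
  have "\<exists>Av. QV k Av" if k: "k \<in> {1..n}" for k
  proof (cases "k = n \<and> c n = 0")
    \<comment> \<open>Points of \<open>M\<close> come arbitrarily close to this face, so no fixed finite cover of the face will do;
      here the semicomputability of \<open>T\<close> is needed.\<close>
    case True
    obtain Av where Av: "semidecidable Av" "\<forall>e. Av e \<longrightarrow> B e \<inter> T = {}"
      "\<forall>P. compact P \<longrightarrow> T \<inter> P = {} \<longrightarrow> (\<exists>\<epsilon>>0. \<forall>e. rad e < \<epsilon> \<longrightarrow> B e \<inter> P \<noteq> {} \<longrightarrow> Av e)"
      using avoid_semicomputable[OF T] by (elim exE conjE)
    have lo_k: "cube_lo n c (3 * s) k = 0" using k True s(1) by (simp add: cube_lo_def)
    have "{y \<in> cube n c (3 * s). y k = cube_lo n c (3 * s) k} \<subseteq> halfspace_bd n"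
      using lo_k True cubeH by (auto simp: halfspace_bd_def simp del: atLeastAtMost_iff)
    then have "f ` {y \<in> cube n c (3 * s). y k = cube_lo n c (3 * s) k} \<subseteq> T" using assms(10) by blast
    then have 1: "\<forall>e. Av e \<longrightarrow> B e \<inter> f ` {y \<in> cube n c (3 * s). y k = cube_lo n c (3 * s) k} = {}"
      using Av(2) by blast
    have "\<exists>\<epsilon>>0. \<forall>e. rad e < \<epsilon> \<longrightarrow> B e \<inter> f ` {y \<in> cube n c (4 * s). p k \<le> y k} \<noteq> {} \<longrightarrow> Av e" if p: "p \<in> M" for p
    proof (rule Av(3)[THEN spec, THEN mp, THEN mp])
      show "compact (f ` {y \<in> cube n c (4 * s). p k \<le> y k})" using compact_image_halfcube(2)[OF cont] .
      \<comment> \<open>A point of the chart in \<open>T\<close> has its parameter on the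
        hyperplane, while here \<open>y n\<close> is at least \<open>p n\<close>, which is
        positive.\<close>
      have "f y \<notin> T" if y: "y \<in> cube n c (4 * s)" "p k \<le> y k" for y
      proof
        assume "f y \<in> T"
        have yH: "y \<in> ?H" using y(1) cubeH by blast
        then have "f y \<in> f ` halfspace_bd n" using \<open>f y \<in> T\<close> fH assms(10) by blast
        then obtain z where z: "z \<in> halfspace_bd n" "f y = f z" by blast
        then have "y = z" using inj_onD[OF injf _ yH] by (auto simp: halfspace_bd_def)
        then have "y n = 0" using z(1) by (simp add: halfspace_bd_def)
        then show False using y(2) p True by (simp add: M_def)
      qed
      then show "T \<inter> f ` {y \<in> cube n c (4 * s). p k \<le> y k} = {}" by blast
    qed
    then show ?thesis using Av(1) 1 unfolding QV_def by blast
  next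
    case False
    let ?C = "f ` {y \<in> cube n c (3 * s). y k \<le> c k - 3 * s}"
    let ?P = "f ` {y \<in> cube n c (4 * s). c k - 2 * s \<le> y k}"
    have "?C \<inter> ?P = {}"
      using s(1) inj_onD[OF injf] cubeH by fastforce
    then obtain Av \<epsilon> where Av: "semidecidable Av" "\<forall>e. Av e \<longrightarrow> B e \<inter> ?C = {}"
      and \<epsilon>: "0 < \<epsilon>" "\<forall>e. rad e < \<epsilon> \<longrightarrow> B e \<inter> ?P \<noteq> {} \<longrightarrow> Av e"
      using avoid_compact[of ?C ?P] compact_image_halfcube[OF cont] by blast
    \<comment> \<open>No clipping occurs: either \<open>k\<close> differs from \<open>n\<close>, or
      \<open>c n\<close> exceeds \<open>4 * s\<close>.\<close>
    have "cube_lo n c (3 * s) k = c k - 3 * s" using k False s(1,3) by (auto simp: cube_lo_def)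
    then have 1: "\<forall>e. Av e \<longrightarrow> B e \<inter> f ` {y \<in> cube n c (3 * s). y k = cube_lo n c (3 * s) k} = {}"
      using Av(2) by fastforce
    have 2: "{y \<in> cube n c (4 * s). p k \<le> y k} \<subseteq> {y \<in> cube n c (4 * s). c k - 2 * s \<le> y k}" if "p \<in> M" for p
      using Mb[OF that k] by auto
    have "\<exists>\<epsilon>>0. \<forall>e. rad e < \<epsilon> \<longrightarrow> B e \<inter> f ` {y \<in> cube n c (4 * s). p k \<le> y k} \<noteq> {} \<longrightarrow> Av e" if "p \<in> M" for p
      using \<epsilon> image_mono[OF 2[OF that], of f] by blast
    then show ?thesis using Av(1) 1 unfolding QV_def by blast
  qed
  then obtain AvV where AvV: "\<And>k. k \<in> {1..n} \<Longrightarrow> QV k (AvV k)" by metis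
  have "\<exists>Hit. semidecidable Hit \<and> (\<forall>e. Hit e \<longrightarrow> B e \<inter> f ` cube n c (3 * s) \<noteq> {}) \<and>
    (\<forall>e. \<forall>p\<in>M. f p \<in> B e \<longrightarrow> Hit e)"
  proof (rule semidecidable_hit[where rlo = "cube_lo n c (4 * s)" and rhi = "cube_hi n c (4 * s)"
        and n = n and Out = Out and AvU = AvU and AvV = AvV])
    show "semicomputable S" by fact
    show "cube_lo n c (4 * s) i = cube_hi n c (4 * s) i" if "i \<notin> {1..n}" for i
      using that by (auto simp: cube_lo_def cube_hi_def)
    have "c \<in> cube n c (3 * s)" using c(1) s(1) mem by auto
    then show "cube_lo n c (3 * s) \<le> cube_hi n c (3 * s)" by auto
    show "cube n c (3 * s) \<subseteq> cube n c (4 * s)" using cube_mono s(1) by simp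
    show "finite Out" by fact
    show "S \<subseteq> f ` cube n c (4 * s) \<union> (\<Union>e\<in>Out. B e)" using Out(2) open_sub by blast
    show "M \<subseteq> cube n c (4 * s)" using cube_mono[of "2 * s" "4 * s"] s(1) unfolding M_def by auto
  qed (use cont inj fcubeS Out(3) AvU AvV in \<open>auto simp: QU_def QV_def\<close>)
  then obtain Hit where Hit: "semidecidable Hit" "\<And>e. Hit e \<Longrightarrow> B e \<inter> f ` cube n c (3 * s) \<noteq> {}"
    "\<And>e p. p \<in> M \<Longrightarrow> f p \<in> B e \<Longrightarrow> Hit e"
    by blast
  have c_in: "c \<in> open_cube n c s" using c(1) s(1) by (simp add: open_cube_def)
  have "computable_upto \<alpha> \<sigma> \<eta> (f ` cube n c s) S"
  proof (rule computable_upto_if_hit[OF S Hit(1)])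
    show "B e \<inter> S \<noteq> {}" if "Hit e" for e using Hit(2)[OF that] fcubeS by blast
    show "f ` cube n c s \<subseteq> S" by (rule fcubeS)
    show "f ` cube n c s \<noteq> {}" using c_in open_sub by blast
    show "finite Z" by fact
    show "B e \<inter> f ` cube n c s = {}" if "e \<in> Z" for e using Z(3) that by blast
    show "(\<exists>e\<in>Z. y \<in> B e) \<or> (\<exists>e. y \<in> B e \<and> rad e < r \<and> Hit e)" if y: "y \<in> S" and r: "0 < r" for y r
    proof (cases "y \<in> f ` open_cube n c (2 * s)")
      case False
      then show ?thesis using Z(2) y by blast
    next
      case True
      then obtain z where z: "z \<in> open_cube n c (2 * s)" "y = f z" by blast
      then have zH: "z \<in> ?H" and zb: "\<And>i. i \<in> {1..n} \<Longrightarrow> \<bar>z i - c i\<bar> < 2 * s" by (auto simp: open_cube_def)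
      obtain e where e: "y \<in> B e" "rad e < r" using ex_small_ball[OF r] by blast
      have "\<exists>p\<in>M. f p \<in> B e"
      proof (cases "z n = 0")
        case False
        then have "0 < z n" using zH by (simp add: halfspace_def)
        then have "z \<in> M" using zH zb mem unfolding M_def by (auto intro: less_imp_le)
        then show ?thesis using z(2) e(1) by blast
      next
        case True
        have "n \<in> {1..n}" using assms(8) by simp
        \<comment> \<open>Otherwise \<open>c n\<close> would exceed \<open>4 * s\<close>, although
          it is within \<open>2 * s\<close> of \<open>z n = 0\<close>.\<close>
        then have cn0: "c n = 0" using zb[of n] True s by fastforce
        obtain \<gamma> where \<gamma>: "0 < \<gamma>" "\<And>p. p \<in> ?H \<Longrightarrow> \<forall>i\<in>{1..n}. \<bar>p i - z i\<bar> < \<gamma> \<Longrightarrow> f p \<in> B e"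
          using continuous_on_halfspace_neighborhood[OF contf zH _ open_ball] e(1) z(2)
          by blast
        \<comment> \<open>Pushing the point off the hyperplane: the bound
          \<open>\<gamma> / 2\<close> keeps its image in the ball, and the bound \<open>s\<close>
          keeps the parameter in the cube of radius \<open>2 * s\<close>.\<close>
        define p where "p = z(n := min (\<gamma> / 2) s)"
        have p: "p \<in> ?H" "0 < p n" using zH assms(8) \<gamma>(1) s(1) by (auto simp: p_def halfspace_def Rn_def)
        have "\<bar>p i - c i\<bar> \<le> 2 * s" if "i \<in> {1..n}" for i
          using zb[OF that] cn0 s(1) \<gamma>(1) by (auto simp: p_def)
        then have "p \<in> M" using p mem unfolding M_def by blast
        moreover have "f p \<in> B e" using p(1) True \<gamma>(1) s(1) by (intro \<gamma>(2)) (auto simp: p_def)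
        ultimately show ?thesis by blast
      qed
      then show ?thesis using e Hit(3) by blast
    qed
  qed
  moreover have "neighborhood_in S x (f ` cube n c s)"
  proof -
    obtain W' where W': "open W'" "f ` open_cube n c s = S \<inter> W'" using open_cube_open[of s] s(1) by auto
    then have "openin (top_of_set S) (f ` open_cube n c s)" by auto
    moreover have "x \<in> f ` open_cube n c s" using c(2) c_in by blast
    moreover have "f ` open_cube n c s \<subseteq> f ` cube n c s" using open_sub by (rule image_mono)
    ultimately show ?thesis
      unfolding neighborhood_in_def using fcubeS[of s] by (intro conjI exI[of _ "f ` open_cube n c s"])
  qed
  ultimately show ?thesis by blast
qed


end
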